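(* Let $k,n\in\mathbb Z_{>0}$, $m=(m_1,\dots,m_n)\in\mathbb Z_{>0}^n$, $\kappa\in\mathbb Z_{>0}$, and let $p>2$ be a prime not dividing $\kappa$. Let $M_s$ ($1\le s\le n$), $M_{i,j}$ ($1\le i<j\le n$), $M^0$ and $K$ be positive integers with $$M_s\equiv-\frac{m_s}\kappa,\qquad M_{i,j}\equiv\frac{m_im_j}{2\kappa},\qquad M^0\equiv\frac2\kappa,\qquad K\equiv\frac1\kappa\pmod p.$$ Let $\ell\in\mathbb Z_{>0}$ be such that $$(\ell-1)K-\sum_{s=1}^nM_s-(k-1)M^0\equiv1\pmod p.$$ Then for any integers $q=(q_1,\dots,q_k)$ and positive integers $l=(l_1,\dots,l_k)$, the vector of polynomials $I^{(l_1p-1,\dots,l_kp-1)}(z,q)$ (defined in the context) satisfies the equation $$(ze)^\ell\,I^{(l_1p-1,\dots,l_kp-1)}(z,q)=0.$$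
   Context: Notation: $t=(t_1,\dots,t_k)$, $z=(z_1,\dots,z_n)$; $|m|=m_1+\dots+m_n$; for $J=(j_1,\dots,j_n)$, $|J|=j_1+\dots+j_n$; $\mathcal I_k=\{J\in\mathbb Z_{\ge0}^n: |J|=k,\ j_s\le m_s\text{ for all }s\}$. Congruences modulo $p$ between integers and rational numbers with denominator prime to $p$ are taken in $\mathbb F_p$. Modules. For an integer $i\ge0$, $L_i$ is the $\mathfrak{sl}_2$-module with basis $v_i,fv_i,\dots,f^iv_i$, in which $e.v_i=0$ and $e.f^rv_i=r(i-r+1)f^{r-1}v_i$ for $1\le r\le i$ (with $h.f^rv_i=(i-2r)f^rv_i$, $f.f^rv_i=f^{r+1}v_i$ for $r<i$, $f.f^iv_i=0$). The structure constants are integers and the modules are considered over $\mathbb F_p$. $L^{\otimes m}=L_{m_1}\otimes\dots\otimes L_{m_n}$ has basis $f_Jv_m:=f^{j_1}v_{m_1}\otimes\dots\otimes f^{j_n}v_{m_n}$, $0\le j_s\le m_s$; the vectors $f_Jv_m$ with $J\in\mathcal I_k$ span $L^{\otimes m}[|m|-2k]$. The operator $ze$ on $L^{\otimes m}\otimes\mathbb F_p[z_1,\dots,z_n]$ is the $\mathbb F_p[z]$-linear operator $$w_1\otimes\dots\otimes w_n\mapsto\sum_{s=1}^nz_s\,w_1\otimes\dots\otimes ew_s\otimes\dots\otimes w_n .$$ Master polynomial: $$\Phi^{(p)}_{k,n,M}(t,z)=\prod_{1\le i<j\le n}(z_i-z_j)^{M_{i,j}}\prod_{1\le i<j\le k}(t_i-t_j)^{M^0}\prod_{s=1}^n\prod_{i=1}^k(t_i-z_s)^{M_s}.$$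 Weight functions: for $J\in\mathcal I_k$, $$W_J(t,z)=\frac1{j_1!\cdots j_n!}\,\mathrm{Sym}_t\Big[\prod_{s=1}^n\prod_{i=1}^{j_s}\frac1{t_{j_1+\dots+j_{s-1}+i}-z_s}\Big],\qquad \mathrm{Sym}_t[F(t_1,\dots,t_k)]=\sum_{\sigma\in S_k}F(t_{\sigma_1},\dots,t_{\sigma_k}).$$ Each $\Phi^{(p)}_{k,n,M}W_J$ is a polynomial in $t,z$ with integer coefficients. For integers $q=(q_1,\dots,q_k)$ consider the Taylor expansion $$\sum_{J\in\mathcal I_k}\Phi^{(p)}_{k,n,M}(t,z)W_J(t,z)\,f_Jv_m=\sum_{i_1,\dots,i_k}\bar I^{(i_1,\dots,i_k)}(z,q)\,(t_1-q_1)^{i_1}\cdots(t_k-q_k)^{i_k},$$ whose coefficients have coordinates (in the basis $f_Jv_m$) that are polynomials in $z$ with integer coefficients; $I^{(i_1,\dots,i_k)}(z,q)\in L^{\otimes m}[|m|-2k]\otimes\mathbb F_p[z]$ denotes the reduction modulo $p$. *)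

theory Defs
  imports
    "HOL-Library.Poly_Mapping"
    "HOL-Computational_Algebra.Fraction_Field"
    "HOL-Combinatorics.Permutations"
    "HOL-Number_Theory.Cong"
    "Berlekamp_Zassenhaus.Finite_Field"
begin

text \<open>
  Polynomials in the variables \<open>x\<^sub>1, x\<^sub>2, \<dots>\<close> over \<open>'a\<close>: finitely supported maps from exponent vectors
  to coefficients. The prime field \<open>\<F>\<^sub>p\<close> is \<open>'p mod_ring\<close> with \<open>CARD('p) = p\<close>. The ring
  \<open>\<int>[t, z]\<close> is represented as \<open>\<int>[z][t]\<close>.
\<close>

type_synonym 'a mpoly = "(nat \<Rightarrow>\<^sub>0 nat) \<Rightarrow>\<^sub>0 'a"

definition var :: "nat \<Rightarrow> 'a::comm_ring_1 mpoly" where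
  "var i = Poly_Mapping.single (Poly_Mapping.single i 1) 1"

definition const :: "'a::comm_ring_1 \<Rightarrow> 'a mpoly" where
  "const c = Poly_Mapping.single 0 c"

abbreviation (input) to_ratfun :: "int mpoly mpoly \<Rightarrow> int mpoly mpoly fract" where
  "to_ratfun P \<equiv> Fract P 1"


definition master_poly ::
  "nat \<Rightarrow> nat \<Rightarrow> (nat \<Rightarrow> nat) \<Rightarrow> (nat \<Rightarrow> nat \<Rightarrow> nat) \<Rightarrow> nat \<Rightarrow> (nat \<Rightarrow> 'a) \<Rightarrow> (nat \<Rightarrow> 'a) \<Rightarrow> 'a::comm_ring_1"
where
  "master_poly k n M M2 M0 t z =
     (\<Prod>i\<in>{1..n}. \<Prod>j\<in>{i<..n}. (z i - z j) ^ M2 i j) *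
     (\<Prod>i\<in>{1..k}. \<Prod>j\<in>{i<..k}. (t i - t j) ^ M0) *
     (\<Prod>s\<in>{1..n}. \<Prod>i\<in>{1..k}. (t i - z s) ^ M s)"

definition index_set :: "nat \<Rightarrow> nat \<Rightarrow> (nat \<Rightarrow> nat) \<Rightarrow> (nat \<Rightarrow> nat) set" where
  "index_set k n m =
     {J. (\<Sum>s\<in>{1..n}. J s) = k \<and> (\<forall>s\<in>{1..n}. J s \<le> m s) \<and> (\<forall>s. s \<notin> {1..n} \<longrightarrow> J s = 0)}"

definition Sym :: "nat \<Rightarrow> ((nat \<Rightarrow> 'a) \<Rightarrow> 'b) \<Rightarrow> (nat \<Rightarrow> 'a) \<Rightarrow> 'b::comm_monoid_add" where
  "Sym k F t = (\<Sum>\<sigma> | \<sigma> permutes {1..k}. F (\<lambda>i. t (\<sigma> i)))"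

definition weight_fun :: "nat \<Rightarrow> nat \<Rightarrow> (nat \<Rightarrow> nat) \<Rightarrow> (nat \<Rightarrow> 'a) \<Rightarrow> (nat \<Rightarrow> 'a) \<Rightarrow> 'a::field" where
  "weight_fun k n J t z =
     1 / (\<Prod>s\<in>{1..n}. of_nat (fact (J s))) *
     Sym k (\<lambda>t. \<Prod>s\<in>{1..n}. \<Prod>i\<in>{1..J s}. 1 / (t ((\<Sum>r\<in>{1..<s}. J r) + i) - z s)) t"

text \<open>
  The product \<open>\<Phi> W\<^sub>J\<close> is formed in the fraction field of \<open>\<int>[z][t]\<close>; for positive exponents
  \<open>M\<^sub>s\<close> it lies in \<open>\<int>[z][t]\<close>, and \<open>master_weight\<close> is that polynomial.
\<close>

definition master_weight ::
  "nat \<Rightarrow> nat \<Rightarrow> (nat \<Rightarrow> nat) \<Rightarrow> (nat \<Rightarrow> nat \<Rightarrow> nat) \<Rightarrow> nat \<Rightarrow> (nat \<Rightarrow> nat) \<Rightarrow> int mpoly mpoly"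
where
  "master_weight k n M M2 M0 J =
     (let t = (\<lambda>i. to_ratfun (var i)); z = (\<lambda>s. to_ratfun (const (var s)))
      in THE P. to_ratfun P = master_poly k n M M2 M0 t z * weight_fun k n J t z)"

text \<open>
  \<open>c\<close> is the family of coefficients of the expansion of \<open>P\<close> in powers of \<open>t\<^sub>j - q\<^sub>j\<close>. It exists and is
  unique; values \<open>q j\<close> for variables \<open>t\<^sub>j\<close> not occurring in \<open>P\<close> do not matter.
\<close>

definition is_taylor_expansion ::
  "(nat \<Rightarrow> int) \<Rightarrow> 'a::comm_ring_1 mpoly \<Rightarrow> ((nat \<Rightarrow>\<^sub>0 nat) \<Rightarrow>\<^sub>0 'a) \<Rightarrow> bool"
where
  "is_taylor_expansion q P c \<longleftrightarrow>
     P = (\<Sum>e\<in>Poly_Mapping.keys c. const (Poly_Mapping.lookup c e) *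
            (\<Prod>j\<in>Poly_Mapping.keys e. (var j - of_int (q j)) ^ Poly_Mapping.lookup e j))"

definition taylor_coeff :: "(nat \<Rightarrow> int) \<Rightarrow> 'a::comm_ring_1 mpoly \<Rightarrow> (nat \<Rightarrow>\<^sub>0 nat) \<Rightarrow> 'a" where
  "taylor_coeff q P e = Poly_Mapping.lookup (THE c. is_taylor_expansion q P c) e"


text \<open>
  Elements of \<open>L\<^sub>i \<otimes> R\<close> are given by their coordinates in the basis \<open>v\<^sub>i, f v\<^sub>i, \<dots>, f\<^sup>i v\<^sub>i\<close>, that is, as
  functions on \<open>{0..i}\<close>; elements of \<open>L\<^sub>m\<^sub>1 \<otimes> \<dots> \<otimes> L\<^sub>m\<^sub>n \<otimes> R\<close> by their coordinates in the basis
  \<open>f\<^sub>J v\<^sub>m\<close>, where a multi-index \<open>J\<close> is a function that vanishes outside \<open>{1..n}\<close>. Of the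
  \<open>sl\<^sub>2\<close>-action only \<open>e\<close> is needed.
\<close>

definition e_act :: "nat \<Rightarrow> (nat \<Rightarrow> 'a) \<Rightarrow> nat \<Rightarrow> 'a::comm_ring_1" where
  "e_act i w = (\<lambda>r'. \<Sum>r\<in>{1..i}. w r * (if r' = r - 1 then of_nat (r * (i - r + 1)) else 0))"

definition e_act_slot ::
  "(nat \<Rightarrow> nat) \<Rightarrow> nat \<Rightarrow> ((nat \<Rightarrow> nat) \<Rightarrow> 'a) \<Rightarrow> (nat \<Rightarrow> nat) \<Rightarrow> 'a::comm_ring_1"
where
  "e_act_slot m s w = (\<lambda>J. e_act (m s) (\<lambda>r. w (J(s := r))) (J s))"

definition ze ::
  "nat \<Rightarrow> (nat \<Rightarrow> nat) \<Rightarrow> ((nat \<Rightarrow> nat) \<Rightarrow> 'a mpoly) \<Rightarrow> (nat \<Rightarrow> nat) \<Rightarrow> 'a::comm_ring_1 mpoly"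
where
  "ze n m w = (\<lambda>J. \<Sum>s\<in>{1..n}. var s * e_act_slot m s w J)"

text \<open>
  On pure tensors, \<open>ze\<close> is \<open>w\<^sub>1 \<otimes> \<dots> \<otimes> w\<^sub>n \<mapsto> \<Sum>\<^sub>s z\<^sub>s w\<^sub>1 \<otimes> \<dots> \<otimes> e w\<^sub>s \<otimes> \<dots> \<otimes> w\<^sub>n\<close>.
\<close>

definition tensor :: "nat \<Rightarrow> (nat \<Rightarrow> nat \<Rightarrow> 'a) \<Rightarrow> (nat \<Rightarrow> nat) \<Rightarrow> 'a::comm_ring_1" where
  "tensor n w = (\<lambda>J. if \<forall>s. s \<notin> {1..n} \<longrightarrow> J s = 0 then \<Prod>s\<in>{1..n}. w s (J s) else 0)"

lemma ze_tensor:
  "ze n m (tensor n w) = (\<lambda>J. \<Sum>s\<in>{1..n}. var s * tensor n (w(s := e_act (m s) (w s))) J)"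
proof -
  have "e_act_slot m s (tensor n w) J = tensor n (w(s := e_act (m s) (w s))) J"
    if s: "s \<in> {1..n}" for s J
  proof -
    define S where "S \<longleftrightarrow> (\<forall>u. u \<notin> {1..n} \<longrightarrow> J u = 0)"
    define P where "P = (\<Prod>u\<in>{1..n} - {s}. w u (J u))"
    have "(\<forall>u. u \<notin> {1..n} \<longrightarrow> (J(s := r)) u = 0) \<longleftrightarrow> S" for r
      using s by (auto simp: S_def)
    moreover have "(\<Prod>u\<in>{1..n}. w u ((J(s := r)) u)) = w s r * P" for r
      using s unfolding P_def
      by (subst prod.remove[of _ s]) (auto intro!: arg_cong2[where f = "(*)"] prod.cong)
    ultimately have slot: "tensor n w (J(s := r)) = (if S then w s r * P else 0)" for r
      unfolding tensor_def by (simp only:)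
    have "(\<Prod>u\<in>{1..n}. (w(s := x)) u (J u)) = x (J s) * P" for x
      using s unfolding P_def
      by (subst prod.remove[of _ s]) (auto intro!: arg_cong2[where f = "(*)"] prod.cong)
    then have "tensor n (w(s := x)) J = (if S then x (J s) * P else 0)" for x
      unfolding tensor_def S_def by (simp only:)
    then show ?thesis
      by (cases S) (simp_all add: e_act_slot_def slot e_act_def sum_distrib_left sum_distrib_right mult_ac)
  qed
  then show ?thesis
    by (simp add: ze_def fun_eq_iff)
qed


text \<open>
  The vectors \<open>I\<^sup>e(z, q)\<close>, with \<open>e\<close> the exponent vector of the Taylor monomial, before and after
  reduction modulo \<open>p\<close>.
\<close>

definition hypergeom_int ::
  "nat \<Rightarrow> nat \<Rightarrow> (nat \<Rightarrow> nat) \<Rightarrow> (nat \<Rightarrow> nat) \<Rightarrow> (nat \<Rightarrow> nat \<Rightarrow> nat) \<Rightarrow> nat \<Rightarrow> (nat \<Rightarrow> int) \<Rightarrow>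
    (nat \<Rightarrow>\<^sub>0 nat) \<Rightarrow> (nat \<Rightarrow> nat) \<Rightarrow> int mpoly"
where
  "hypergeom_int k n m M M2 M0 q e = (\<lambda>J.
     if J \<in> index_set k n m then taylor_coeff q (master_weight k n M M2 M0 J) e else 0)"

definition hypergeom_mod ::
  "nat \<Rightarrow> nat \<Rightarrow> (nat \<Rightarrow> nat) \<Rightarrow> (nat \<Rightarrow> nat) \<Rightarrow> (nat \<Rightarrow> nat \<Rightarrow> nat) \<Rightarrow> nat \<Rightarrow> (nat \<Rightarrow> int) \<Rightarrow>
    (nat \<Rightarrow>\<^sub>0 nat) \<Rightarrow> (nat \<Rightarrow> nat) \<Rightarrow> 'p::prime_card mod_ring mpoly"
where
  "hypergeom_mod k n m M M2 M0 q e = (\<lambda>J. Poly_Mapping.map of_int (hypergeom_int k n m M M2 M0 q e J))"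

end

theory Submission
  imports Defs "HOL-Computational_Algebra.Polynomial_Factorial"
begin

text \<open>
  Everything is read off from the generating function
  \[ G = \prod_{i=1}^k g_i, \qquad g_i = x_0 + \sum_{s=1}^n \frac{x_s}{t_i - z_s} . \]
  The weight function \<open>W\<^sub>J\<close> is the coefficient of \<open>x\<^sup>J\<close> in \<open>G\<close> (lemma \<open>weight_fun_eq_lookup\<close>). The coefficient
  of \<open>x\<^sub>0\<^sup>r x\<^sup>J\<close> is the sum, over all ways to leave out \<open>r\<close> of the variables \<open>t\<^sub>i\<close>, of the weight functions of the
  remaining \<open>k - r\<close> variables. On coefficients, \<open>ze\<close> acts as the differential operator
  \<open>\<Sum>\<^sub>s z\<^sub>s (m\<^sub>s \<partial>\<^sub>s - x\<^sub>s \<partial>\<^sub>s\<^sup>2)\<close> in the variables \<open>x\<^sub>s\<close>.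

  The total derivative \<open>\<Sum>\<^sub>i \<partial>/\<partial>t\<^sub>i (t\<^sub>i \<Phi> G / g\<^sub>i)\<close> can be computed in closed form, by partial fractions in
  \<open>t\<^sub>i\<close> and \<open>t\<^sub>j\<close> (lemmas \<open>exchange_identity\<close> and \<open>core_identity\<close>): it equals \<open>\<Phi>\<close> times
  \[ \Bigl(1 + \sum_s M_s + (k-1) M^0\Bigr) \partial_0 G - \frac{M^0}{2} x_0 \partial_0^2 G
     + \sum_s z_s \Bigl(M_s \partial_s + \frac{M^0}{2} x_s \partial_s^2\Bigr) G . \]
  Modulo \<open>p\<close>, where \<open>M\<^sub>s \<equiv> -m\<^sub>s/\<kappa>\<close> and \<open>M\<^sup>0/2 \<equiv> K \<equiv> 1/\<kappa>\<close>, the sum over \<open>s\<close> is \<open>-1/\<kappa>\<close> times the operator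
  \<open>ze\<close>. On the coefficients of \<open>x\<^sub>0\<^sup>r\<close> the first two terms are the scalar
  \<open>(r + 1) (1 + \<Sum>\<^sub>s M\<^sub>s + (k - 1) M\<^sup>0 - r K)\<close> times the coefficients of \<open>x\<^sub>0\<^bsup>r + 1\<^esup>\<close>.

  Coefficients at \<open>\<Prod>\<^sub>i (t\<^sub>i - q\<^sub>i)\<^bsup>l\<^sub>i p - 1\<^esup>\<close> of derivatives vanish modulo \<open>p\<close> (lemma \<open>reduced_taylor_coeff_pd\<close>).
  Hence, after taking these coefficients, \<open>ze\<close> maps the vector of level \<open>r\<close> to a scalar multiple of the
  vector of level \<open>r + 1\<close> (lemma \<open>ze_level_vector\<close>). The vector in question has level 0, and the scalar
  met in the step from level \<open>\<ell> - 1\<close> to level \<open>\<ell>\<close> is zero by the congruence that defines \<open>\<ell>\<close>.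
\<close>

section \<open>Coefficients and induction for multivariate polynomials\<close>

lemma mpoly_single_induct [case_names single add]:
  assumes s: "\<And>e a. P (Poly_Mapping.single e a)"
    and a: "\<And>f g. P f \<Longrightarrow> P g \<Longrightarrow> P (f + g)"
  shows "P (f :: 'k \<Rightarrow>\<^sub>0 'a::comm_monoid_add)"
proof (induction f rule: update_induct)
  case const
  show ?case using s[of undefined 0] by simp
next
  case (update f k b)
  have "Poly_Mapping.update k b f = f + Poly_Mapping.single k b"
    using update(1) by (intro poly_mapping_eqI)
      (auto simp: lookup_update lookup_add lookup_single when_def not_in_keys_iff_lookup_eq_zero)
  then show ?case using a[OF update(3) s] by simp
qed

lemma const_0 [simp]: "const 0 = 0"
  and const_1 [simp]: "const 1 = 1"
  by (simp_all add: const_def)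

lemma const_add: "const (a + b) = const a + const b"
  by (simp add: const_def single_add)

lemma const_mult: "const (a * b) = const a * const b"
  by (simp add: const_def mult_single)

interpretation const_hom: comm_ring_hom "const :: 'a::comm_ring_1 \<Rightarrow> 'a mpoly"
  by unfold_locales (simp_all add: const_add const_mult)

lemma var_power: "var i ^ r = Poly_Mapping.single (Poly_Mapping.single i r) 1"
  by (induction r) (simp_all add: var_def mult_single single_add[symmetric])

lemma single_as_monomial:
  "Poly_Mapping.single e a =
     const a * (\<Prod>j\<in>Poly_Mapping.keys e. var j ^ Poly_Mapping.lookup e j)"
proof -
  have "(\<Prod>j\<in>A. var j ^ Poly_Mapping.lookup e j) =
      Poly_Mapping.single (\<Sum>j\<in>A. Poly_Mapping.single j (Poly_Mapping.lookup e j)) (1::'a)"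
    if "finite A" for A
    using that by (induction A rule: finite_induct) (simp_all add: var_power mult_single)
  moreover have "(\<Sum>j\<in>Poly_Mapping.keys e. Poly_Mapping.single j (Poly_Mapping.lookup e j)) = e"
    by (intro poly_mapping_eqI)
      (simp add: lookup_sum lookup_single when_def not_in_keys_iff_lookup_eq_zero)
  ultimately show ?thesis
    by (simp add: const_def mult_single)
qed

text \<open>
  Two maps built from ring homomorphisms and derivations agree as soon as they agree on constants and
  variables. This rule delivers that principle for composites such as \<open>pd i \<circ> translate q\<close>.
\<close>

lemma mpoly_induct [case_names const var add mult]:
  assumes c: "\<And>a. P (const a)" and v: "\<And>i. P (var i)"
    and a: "\<And>f g. P f \<Longrightarrow> P g \<Longrightarrow> P (f + g)"
    and m: "\<And>f g. P f \<Longrightarrow> P g \<Longrightarrow> P (f * g)"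
  shows "P (f :: 'a::comm_ring_1 mpoly)"
proof (induction f rule: mpoly_single_induct)
  case (single e b)
  have pw: "P (var i ^ r)" for i r
    using c[of 1] by (induction r) (auto intro: m v)
  have "P (\<Prod>j\<in>A. var j ^ Poly_Mapping.lookup e j)" if "finite A" for A
    using that c[of 1] by (induction A rule: finite_induct) (auto intro: m pw)
  then show ?case
    unfolding single_as_monomial by (intro m c) simp
qed (rule a)

lemma lookup_const_times: "Poly_Mapping.lookup (const a * f) e = a * Poly_Mapping.lookup f e"
proof (induction f rule: mpoly_single_induct)
  case (single e' b)
  show ?case by (simp add: const_def mult_single lookup_single mult_when)
qed (simp add: lookup_add distrib_left)

lemma lookup_var_times:
  "Poly_Mapping.lookup (var i * f) (e + Poly_Mapping.single i 1) = Poly_Mapping.lookup f e"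
proof (induction f rule: mpoly_single_induct)
  case (single e' b)
  show ?case
    by (simp add: var_def mult_single lookup_single when_def add.commute[of e])
qed (simp add: lookup_add distrib_left)

lemma lookup_var_times_0:
  "Poly_Mapping.lookup e i = 0 \<Longrightarrow> Poly_Mapping.lookup (var i * f) e = 0"
proof (induction f rule: mpoly_single_induct)
  case (single e' b)
  then show ?case
    by (auto simp: var_def mult_single lookup_single lookup_add when_def)
qed (simp add: lookup_add distrib_left)

section \<open>Derivations and partial derivatives\<close>

locale derivation =
  fixes d :: "'a::comm_ring_1 \<Rightarrow> 'a"
  assumes add: "d (a + b) = d a + d b"
    and mult: "d (a * b) = d a * b + a * d b"
begin

lemma zero [simp]: "d 0 = 0"
  using add[of 0 0] by simp

lemma one [simp]: "d 1 = 0"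
  using mult[of 1 1] by simp

lemma uminus: "d (- a) = - d a"
  using add[of a "- a"] by (simp add: eq_neg_iff_add_eq_0 add.commute)

lemma diff: "d (a - b) = d a - d b"
  using add[of a "- b"] by (simp add: uminus)

lemma sum: "d (\<Sum>i\<in>A. f i) = (\<Sum>i\<in>A. d (f i))"
  by (induction A rule: infinite_finite_induct) (simp_all add: add)

lemma prod:
  "finite A \<Longrightarrow> d (\<Prod>i\<in>A. f i) = (\<Sum>i\<in>A. d (f i) * (\<Prod>j\<in>A - {i}. f j))"
proof (induction A rule: finite_induct)
  case (insert x A)
  have "insert x A - {i} = insert x (A - {i})" if "i \<in> A" for i
    using that insert by auto
  then show ?case
    using insert by (auto simp: mult sum_distrib_left mult_ac intro!: sum.cong)
qed simp

lemma prod_const: "(\<And>i. i \<in> A \<Longrightarrow> d (f i) = 0) \<Longrightarrow> d (\<Prod>i\<in>A. f i) = 0"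
  by (induction A rule: infinite_finite_induct) (simp_all add: mult)

end

text \<open>
  The exponent vector is shifted upwards here, so that no truncated subtraction enters the formula for
  the coefficients.
\<close>

definition pd :: "nat \<Rightarrow> 'a::comm_ring_1 mpoly \<Rightarrow> 'a mpoly" where
  "pd i f = Abs_poly_mapping
     (\<lambda>e. of_nat (Poly_Mapping.lookup e i + 1) * Poly_Mapping.lookup f (e + Poly_Mapping.single i 1))"

lemma lookup_pd:
  "Poly_Mapping.lookup (pd i f) e =
     of_nat (Poly_Mapping.lookup e i + 1) * Poly_Mapping.lookup f (e + Poly_Mapping.single i 1)"
proof -
  let ?g = "\<lambda>e. of_nat (Poly_Mapping.lookup e i + 1) * Poly_Mapping.lookup f (e + Poly_Mapping.single i 1)"
  have "{e. ?g e \<noteq> 0} \<subseteq> (\<lambda>e. e + Poly_Mapping.single i 1) -` Poly_Mapping.keys f"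
    by (auto simp: in_keys_iff)
  moreover have "finite ((\<lambda>e. e + Poly_Mapping.single i 1) -` Poly_Mapping.keys f)"
    by (intro finite_vimageI) (auto simp: inj_def)
  ultimately have "finite {e. ?g e \<noteq> 0}"
    using finite_subset by blast
  then show ?thesis
    unfolding pd_def by simp
qed

lemma pd_add: "pd i (f + g) = pd i f + pd i g"
  by (intro poly_mapping_eqI) (simp add: lookup_pd lookup_add distrib_left)

lemma pd_single:
  "pd i (Poly_Mapping.single e a) =
     Poly_Mapping.single (e - Poly_Mapping.single i 1) (of_nat (Poly_Mapping.lookup e i) * a)"
proof (intro poly_mapping_eqI)
  fix e' :: "nat \<Rightarrow>\<^sub>0 nat"
  have 1: "e' + Poly_Mapping.single i 1 - Poly_Mapping.single i 1 = e'" by simp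
  have 2: "Poly_Mapping.lookup e i = 0"
    if "e - Poly_Mapping.single i 1 = e'" "e \<noteq> e' + Poly_Mapping.single i 1"
  proof (rule ccontr)
    assume "Poly_Mapping.lookup e i \<noteq> 0"
    then have "e - Poly_Mapping.single i 1 + Poly_Mapping.single i 1 = e"
      by (intro poly_mapping_eqI) (auto simp: lookup_add lookup_minus lookup_single when_def)
    with that show False by simp
  qed
  show "Poly_Mapping.lookup (pd i (Poly_Mapping.single e a)) e' =
     Poly_Mapping.lookup (Poly_Mapping.single (e - Poly_Mapping.single i 1) (of_nat (Poly_Mapping.lookup e i) * a)) e'"
    unfolding lookup_pd lookup_single when_def using 1 2
    by (auto simp: lookup_add)
qed

interpretation pd: derivation "pd i :: 'a::comm_ring_1 mpoly \<Rightarrow> 'a mpoly" for i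
proof
  let ?x = "Poly_Mapping.single i (1::nat)"
  have shift: "e + e' - ?x = e - ?x + e'" if "Poly_Mapping.lookup e i \<noteq> 0" for e e' :: "nat \<Rightarrow>\<^sub>0 nat"
    using that by (intro poly_mapping_eqI) (auto simp: lookup_add lookup_minus lookup_single when_def)
  have s: "Poly_Mapping.single (e + e' - ?x) (of_nat (Poly_Mapping.lookup e i) * b) =
      Poly_Mapping.single (e - ?x + e') (of_nat (Poly_Mapping.lookup e i) * (b::'a))" for e e' b
  proof (cases "Poly_Mapping.lookup e i = 0")
    case True
    then show ?thesis by simp
  next
    case False
    then show ?thesis by (simp only: shift[OF False])
  qed
  show "pd i (f * g) = pd i f * g + f * pd i g" for f g :: "'a mpoly"
  proof (induction f rule: mpoly_single_induct)
    case (single e a)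
    show ?case
    proof (induction g rule: mpoly_single_induct)
      case (single e' b)
      show ?case
        using s[of e e' "a * b"] s[of e' e "a * b"]
        by (simp add: pd_single mult_single lookup_add distrib_left distrib_right single_add mult_ac add_ac)
    next
      case (add f g)
      then show ?case by (simp add: pd_add algebra_simps)
    qed
  next
    case (add f g)
    then show ?case by (simp add: pd_add algebra_simps)
  qed
qed (rule pd_add)

lemma pd_const [simp]: "pd i (const a) = 0"
  by (simp add: const_def pd_single)

lemma pd_var: "pd i (var j) = (if i = j then 1 else 0)"
  by (simp add: var_def pd_single lookup_single when_def)

text \<open>
  The operator \<open>x\<^sub>i \<partial>\<^sub>i\<^sup>2\<close> shifts coefficients exactly like \<open>\<partial>\<^sub>i\<close> does, only with an extra factor
  equal to the exponent. So combinations of \<open>\<partial>\<^sub>i\<close> and \<open>x\<^sub>i \<partial>\<^sub>i\<^sup>2\<close> produce the quadratic structure constants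
  \<open>(r + 1) (m - r)\<close> of the raising operator \<open>e\<close>.
\<close>

lemma lookup_var_pd_pd:
  "Poly_Mapping.lookup (var i * pd i (pd i f)) e =
    of_nat (Poly_Mapping.lookup e i * (Poly_Mapping.lookup e i + 1)) *
      Poly_Mapping.lookup f (e + Poly_Mapping.single i 1)"
proof (cases "Poly_Mapping.lookup e i")
  case 0
  then show ?thesis by (simp add: lookup_var_times_0)
next
  case (Suc r)
  define e' where "e' = e - Poly_Mapping.single i 1"
  have e: "e = e' + Poly_Mapping.single i 1"
    using Suc unfolding e'_def
    by (intro poly_mapping_eqI) (auto simp: lookup_add lookup_minus lookup_single when_def)
  show ?thesis
    unfolding e lookup_var_times by (simp add: lookup_pd lookup_add algebra_simps)
qed

section \<open>Coefficientwise homomorphisms and derivations\<close>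

lemma lookup_map_zero: "h 0 = 0 \<Longrightarrow> Poly_Mapping.lookup (Poly_Mapping.map h f) e = h (Poly_Mapping.lookup f e)"
  by (simp add: Poly_Mapping.map.rep_eq when_def)

lemma (in comm_ring_hom) map_mpoly_hom:
  "comm_ring_hom (Poly_Mapping.map hom :: 'a mpoly \<Rightarrow> 'b mpoly)"
proof
  let ?h = "Poly_Mapping.map hom :: 'a mpoly \<Rightarrow> 'b mpoly"
  show add: "?h (f + g) = ?h f + ?h g" for f g
    by (intro poly_mapping_eqI) (simp add: lookup_map_zero lookup_add hom_distribs)
  have single: "?h (Poly_Mapping.single e a) = Poly_Mapping.single e (hom a)" for e a
    by (intro poly_mapping_eqI) (simp add: lookup_map_zero lookup_single when_def)
  show "?h 0 = 0" by (intro poly_mapping_eqI) (simp add: lookup_map_zero)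
  show "?h 1 = 1" using single[of 0 1] by simp
  show "?h (f * g) = ?h f * ?h g" for f g
  proof (induction f rule: mpoly_single_induct)
    case (single e a)
    show ?case
    proof (induction g rule: mpoly_single_induct)
      case (single e' b)
      show ?case
        using \<open>\<And>e a. ?h (Poly_Mapping.single e a) = Poly_Mapping.single e (hom a)\<close>
        by (simp add: mult_single hom_distribs)
    next
      case (add f g)
      then show ?case by (simp add: \<open>\<And>f g. ?h (f + g) = ?h f + ?h g\<close> algebra_simps)
    qed
  next
    case (add f g)
    then show ?case by (simp add: \<open>\<And>f g. ?h (f + g) = ?h f + ?h g\<close> algebra_simps)
  qed
qed

lemma (in comm_ring_hom) map_mpoly_const: "Poly_Mapping.map hom (const a) = const (hom a)"
  by (intro poly_mapping_eqI) (simp add: lookup_map_zero const_def lookup_single when_def)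

lemma (in comm_ring_hom) map_mpoly_var: "Poly_Mapping.map hom (var i) = var i"
  by (intro poly_mapping_eqI) (simp add: lookup_map_zero var_def lookup_single when_def)

lemma (in derivation) map_mpoly_derivation:
  "derivation (Poly_Mapping.map d :: 'a mpoly \<Rightarrow> 'a mpoly)"
proof
  let ?h = "Poly_Mapping.map d :: 'a mpoly \<Rightarrow> 'a mpoly"
  show ad: "?h (f + g) = ?h f + ?h g" for f g
    by (intro poly_mapping_eqI) (simp add: lookup_map_zero lookup_add add)
  have single: "?h (Poly_Mapping.single e a) = Poly_Mapping.single e (d a)" for e a
    by (intro poly_mapping_eqI) (simp add: lookup_map_zero lookup_single when_def)
  show "?h (f * g) = ?h f * g + f * ?h g" for f g
  proof (induction f rule: mpoly_single_induct)
    case (single e a)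
    show ?case
    proof (induction g rule: mpoly_single_induct)
      case (single e' b)
      show ?case
        using \<open>\<And>e a. ?h (Poly_Mapping.single e a) = Poly_Mapping.single e (d a)\<close>
        by (simp add: mult_single mult single_add)
    next
      case (add f g)
      then show ?case by (simp add: ad algebra_simps)
    qed
  next
    case (add f g)
    then show ?case by (simp add: ad algebra_simps)
  qed
qed

lemma (in derivation) map_mpoly_const: "Poly_Mapping.map d (const a) = const (d a)"
  by (intro poly_mapping_eqI) (simp add: lookup_map_zero const_def lookup_single when_def)

lemma (in derivation) map_mpoly_var: "Poly_Mapping.map d (var i) = 0"
  by (intro poly_mapping_eqI) (simp add: lookup_map_zero var_def lookup_single when_def)

section \<open>Taylor expansion as a translation of the variables\<close>

text \<open>
  The right-hand side of a Taylor expansion around \<open>q\<close> is the polynomial of its coefficients with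
  \<open>x\<^sub>j - q\<^sub>j\<close> substituted for \<open>x\<^sub>j\<close>. That substitution is a ring automorphism whose inverse is the
  substitution for \<open>-q\<close>; this gives existence and uniqueness of the expansion at once, and shows that
  Taylor coefficients are ordinary coefficients after a translation that commutes with \<open>\<partial>\<^sub>i\<close>.
\<close>

definition translate :: "(nat \<Rightarrow> int) \<Rightarrow> 'a::comm_ring_1 mpoly \<Rightarrow> 'a mpoly" where
  "translate q c = (\<Sum>e\<in>Poly_Mapping.keys c. const (Poly_Mapping.lookup c e) *
            (\<Prod>j\<in>Poly_Mapping.keys e. (var j - of_int (q j)) ^ Poly_Mapping.lookup e j))"

abbreviation (input) translated_monomial :: "(nat \<Rightarrow> int) \<Rightarrow> (nat \<Rightarrow>\<^sub>0 nat) \<Rightarrow> 'a::comm_ring_1 mpoly" where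
  "translated_monomial q e \<equiv> (\<Prod>j\<in>Poly_Mapping.keys e. (var j - of_int (q j)) ^ Poly_Mapping.lookup e j)"

lemma translated_monomial_superset:
  "finite A \<Longrightarrow> Poly_Mapping.keys e \<subseteq> A \<Longrightarrow>
    translated_monomial q e = (\<Prod>j\<in>A. (var j - of_int (q j)) ^ Poly_Mapping.lookup e j)"
  by (rule prod.mono_neutral_left) (auto simp: not_in_keys_iff_lookup_eq_zero)

lemma translated_monomial_add:
  "translated_monomial q (e + e') = translated_monomial q e * translated_monomial q e'"
proof -
  let ?A = "Poly_Mapping.keys e \<union> Poly_Mapping.keys e'"
  have A: "finite ?A" by simp
  have B: "Poly_Mapping.keys (e + e') \<subseteq> ?A" by (rule keys_add)
  show ?thesis
    unfolding translated_monomial_superset[OF A B]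
      translated_monomial_superset[OF A Un_upper1] translated_monomial_superset[OF A Un_upper2]
    by (simp add: lookup_add power_add prod.distrib)
qed

lemma translate_superset:
  "finite A \<Longrightarrow> Poly_Mapping.keys c \<subseteq> A \<Longrightarrow>
    translate q c = (\<Sum>e\<in>A. const (Poly_Mapping.lookup c e) * translated_monomial q e)"
  unfolding translate_def
  by (rule sum.mono_neutral_left) (auto simp: not_in_keys_iff_lookup_eq_zero)

lemma translate_single: "translate q (Poly_Mapping.single e a) = const a * translated_monomial q e"
  by (cases "a = 0") (simp_all add: translate_def)

lemma translate_add: "translate q (f + g) = translate q f + translate q g"
proof -
  let ?A = "Poly_Mapping.keys f \<union> Poly_Mapping.keys g"
  have A: "finite ?A" by simp
  have B: "Poly_Mapping.keys (f + g) \<subseteq> ?A" by (rule keys_add)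
  show ?thesis
    unfolding translate_superset[OF A B]
      translate_superset[OF A Un_upper1] translate_superset[OF A Un_upper2]
    by (simp add: lookup_add const_add distrib_right sum.distrib)
qed

lemma translate_const [simp]: "translate q (const a) = const a"
  by (simp add: const_def[of a] translate_single)

lemma translate_var [simp]: "translate q (var j) = var j - of_int (q j)"
  by (simp add: var_def[of j] translate_single)

lemma translate_mult: "translate q (f * g) = translate q f * translate q g"
proof (induction f rule: mpoly_single_induct)
  case (single e a)
  show ?case
  proof (induction g rule: mpoly_single_induct)
    case (single e' b)
    show ?case
      unfolding mult_single translate_single translated_monomial_add by (simp add: const_mult mult_ac)
  next
    case (add f g)
    then show ?case by (simp add: translate_add algebra_simps)
  qed
next
  case (add f g)
  then show ?case by (simp add: translate_add algebra_simps)
qed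

interpretation translate: comm_ring_hom "translate q :: 'a::comm_ring_1 mpoly \<Rightarrow> 'a mpoly" for q
proof
  show "translate q (0 :: 'a mpoly) = 0" "translate q (1 :: 'a mpoly) = 1"
    using translate_const[of q "0::'a"] translate_const[of q "1::'a"] by simp_all
qed (simp_all add: translate_add translate_mult)

lemma translate_translate_uminus:
  assumes "\<And>j. q' j = - q j"
  shows "translate q' (translate q f) = f"
  by (induction f rule: mpoly_induct) (simp_all add: hom_distribs assms)

lemma pd_of_int [simp]: "pd i (of_int r) = 0"
  using pd_const[of i "of_int r"] by (simp add: const_hom.hom_of_int)

lemma pd_translate: "pd i (translate q f) = translate q (pd i f)"
  by (induction f rule: mpoly_induct)
    (simp_all add: hom_distribs pd.add pd.mult pd.diff pd_var)

lemma taylor_coeff_eq: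
  "taylor_coeff q f e = Poly_Mapping.lookup (translate (\<lambda>j. - q j) f) e"
proof -
  have "is_taylor_expansion q f c \<longleftrightarrow> c = translate (\<lambda>j. - q j) f" for c
    unfolding is_taylor_expansion_def translate_def[symmetric]
    using translate_translate_uminus[of "\<lambda>j. - q j" q c]
      translate_translate_uminus[of q "\<lambda>j. - q j" f] by auto
  then show ?thesis
    by (simp add: taylor_coeff_def)
qed

section \<open>The exchange identity and its sum over all pairs\<close>

lemma sum_offdiag_swap:
  fixes f :: "nat \<Rightarrow> nat \<Rightarrow> 'a::comm_monoid_add"
  assumes "finite A"
  shows "(\<Sum>i\<in>A. \<Sum>j\<in>A - {i}. f i j) = (\<Sum>i\<in>A. \<Sum>j\<in>A - {i}. f j i)"
proof -
  have "(\<Sum>i\<in>A. \<Sum>j\<in>A - {i}. f i j) = (\<Sum>i\<in>A. \<Sum>j\<in>{j\<in>A. i \<noteq> j}. f i j)"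
    by (intro sum.cong) auto
  also have "\<dots> = (\<Sum>j\<in>A. \<Sum>i\<in>{i\<in>A. i \<noteq> j}. f i j)"
    using assms by (rule sum.swap_restrict) (rule assms)
  also have "\<dots> = (\<Sum>j\<in>A. \<Sum>i\<in>A - {j}. f i j)"
    by (intro sum.cong) auto
  finally show ?thesis .
qed

text \<open>
  The elements \<open>a i s\<close> and \<open>b i j\<close> stand for \<open>1 / (t\<^sub>i - z\<^sub>s)\<close> and \<open>1 / (t\<^sub>i - t\<^sub>j)\<close>. They are given
  abstractly because the identity is needed in a polynomial ring over a field, where division is not
  available.
\<close>

locale points =
  fixes A S :: "nat set" and t z x :: "nat \<Rightarrow> 'a::comm_ring_1" and x0 :: 'a
    and a b :: "nat \<Rightarrow> nat \<Rightarrow> 'a"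
  assumes fin: "finite A" "finite S"
    and a: "i \<in> A \<Longrightarrow> s \<in> S \<Longrightarrow> (t i - z s) * a i s = 1"
    and b: "i \<in> A \<Longrightarrow> j \<in> A \<Longrightarrow> i \<noteq> j \<Longrightarrow> (t i - t j) * b i j = 1"
begin

definition "g i = x0 + (\<Sum>s\<in>S. x s * a i s)"

text \<open>
  The left-hand side is \<open>(t\<^sub>i g\<^sub>j - t\<^sub>j g\<^sub>i) / (t\<^sub>i - t\<^sub>j)\<close>. The pole at \<open>t\<^sub>i = t\<^sub>j\<close> is only apparent, since the
  numerator is antisymmetric; partial fractions leave simple poles at the \<open>z\<^sub>s\<close> and products of two of them.
\<close>

lemma exchange_identity:
  assumes ij: "i \<in> A" "j \<in> A" "i \<noteq> j"
  shows "t i * b i j * g j + t j * b j i * g i =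
    g i + g j - x0 + (\<Sum>s\<in>S. x s * z s * (a i s * a j s))"
proof -
  have "b j i = ((t i - t j) * b i j) * b j i"
    using b[of i j] ij by simp
  also have "\<dots> = - (((t j - t i) * b j i) * b i j)" by (simp add: algebra_simps)
  finally have bji: "b j i = - b i j" using b[of j i] ij by simp
  let ?R = "g i + g j - x0 + (\<Sum>s\<in>S. x s * z s * (a i s * a j s))"
  define c where "c s = x s * a i s + x s * a j s + x s * z s * (a i s * a j s)" for s
  have e: "t i * (x s * a j s) - t j * (x s * a i s) = (t i - t j) * c s" if "s \<in> S" for s
  proof -
    have 1: "t i * a i s = 1 + z s * a i s" and 2: "t j * a j s = 1 + z s * a j s"
      using that ij a[of i s] a[of j s] by (simp_all add: algebra_simps)
    have "(t i - t j) * c s = x s * (t i * a i s + t i * a j s + z s * (t i * a i s) * a j s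
        - (t j * a i s + t j * a j s + z s * a i s * (t j * a j s)))"
      by (simp add: c_def algebra_simps)
    also have "\<dots> = x s * (t i * a j s) - x s * (t j * a i s)"
      unfolding 1 2 by (simp add: algebra_simps)
    finally show ?thesis by (simp add: mult_ac)
  qed
  have "t i * g j - t j * g i = (t i - t j) * x0 + (\<Sum>s\<in>S. t i * (x s * a j s) - t j * (x s * a i s))"
    by (simp add: g_def distrib_left left_diff_distrib sum_distrib_left sum_subtractf)
  also have "(\<Sum>s\<in>S. t i * (x s * a j s) - t j * (x s * a i s)) = (t i - t j) * (\<Sum>s\<in>S. c s)"
    by (simp add: e sum_distrib_left)
  also have "(t i - t j) * x0 + (t i - t j) * (\<Sum>s\<in>S. c s) = (t i - t j) * ?R"
    by (simp add: g_def c_def sum.distrib algebra_simps)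
  finally have "b i j * (t i * g j - t j * g i) = ((t i - t j) * b i j) * ?R" by (simp add: mult_ac)
  then have "b i j * (t i * g j - t j * g i) = ?R" using b[of i j] ij by simp
  then show ?thesis by (simp add: bji algebra_simps)
qed

abbreviation "G B \<equiv> \<Prod>i\<in>B. g i"

text \<open>
  In the generating function \<open>G A = \<Prod>\<^sub>i g\<^sub>i\<close> the sums on the right are the derivatives \<open>\<partial>\<^sub>0 G\<close>, \<open>\<partial>\<^sub>s G\<close>,
  \<open>\<partial>\<^sub>s\<^sup>2 G\<close> and \<open>\<partial>\<^sub>0\<^sup>2 G\<close> with respect to the \<open>x\<close>-variables. The bracket on the left is what
  \<open>\<partial>/\<partial>t\<^sub>i\<close> produces from \<open>t\<^sub>i \<Phi>\<close>. The interaction terms \<open>t\<^sub>i / (t\<^sub>i - t\<^sub>j)\<close> are symmetrised over \<open>i\<close> and \<open>j\<close>,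
  and the exchange identity applies to each pair; the factor 2 compensates for ordered pairs.
\<close>

lemma core_identity:
  fixes M :: "nat \<Rightarrow> 'a" and M0 :: 'a
  shows "2 * (\<Sum>i\<in>A. G (A - {i}) *
           (1 + (\<Sum>s\<in>S. M s * (t i * a i s)) + M0 * (\<Sum>j\<in>A - {i}. t i * b i j))) =
     2 * (1 + (\<Sum>s\<in>S. M s) + (of_nat (card A) - 1) * M0) * (\<Sum>i\<in>A. G (A - {i}))
   + 2 * (\<Sum>s\<in>S. M s * z s * (\<Sum>i\<in>A. a i s * G (A - {i})))
   + M0 * ((\<Sum>s\<in>S. x s * z s * (\<Sum>i\<in>A. \<Sum>j\<in>A - {i}. a i s * (a j s * G (A - {i} - {j}))))
           - x0 * (\<Sum>i\<in>A. \<Sum>j\<in>A - {i}. G (A - {i} - {j})))"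
proof -
  let ?D = "\<Sum>i\<in>A. G (A - {i})"
  have "(\<Sum>i\<in>A. G (A - {i}) * (\<Sum>s\<in>S. M s * (t i * a i s)))
      = (\<Sum>i\<in>A. G (A - {i}) * (\<Sum>s\<in>S. M s + M s * z s * a i s))"
  proof (intro sum.cong refl arg_cong2[where f = "(*)"])
    fix i s assume "i \<in> A" "s \<in> S"
    then have "t i * a i s = 1 + z s * a i s" using a[of i s] by (simp add: algebra_simps)
    then show "M s * (t i * a i s) = M s + M s * z s * a i s" by (simp add: algebra_simps)
  qed
  also have "\<dots> = (\<Sum>s\<in>S. M s) * ?D + (\<Sum>i\<in>A. G (A - {i}) * (\<Sum>s\<in>S. M s * z s * a i s))"
    by (simp only: sum.distrib distrib_left sum_distrib_left[of "sum M S"] mult.commute[of _ "sum M S"])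
  also have "(\<Sum>i\<in>A. G (A - {i}) * (\<Sum>s\<in>S. M s * z s * a i s)) =
      (\<Sum>i\<in>A. \<Sum>s\<in>S. M s * z s * (a i s * G (A - {i})))"
    by (simp only: sum_distrib_left mult_ac)
  also have "\<dots> = (\<Sum>s\<in>S. \<Sum>i\<in>A. M s * z s * (a i s * G (A - {i})))"
    by (rule sum.swap)
  finally have 1: "(\<Sum>i\<in>A. G (A - {i}) * (\<Sum>s\<in>S. M s * (t i * a i s))) =
      (\<Sum>s\<in>S. M s) * ?D + (\<Sum>s\<in>S. M s * z s * (\<Sum>i\<in>A. a i s * G (A - {i})))"
    by (simp only: sum_distrib_left)
  have G1: "G (A - {i}) = g j * G (A - {i} - {j})" if "j \<in> A - {i}" for i j
    using that fin by (intro prod.remove) auto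
  have G2: "G (A - {j}) = g i * G (A - {i} - {j})" if "j \<in> A - {i}" "i \<in> A" for i j
  proof -
    have "A - {j} - {i} = A - {i} - {j}" by auto
    then show ?thesis using prod.remove[of "A - {j}" i g] that fin by auto
  qed
  let ?E = "\<Sum>i\<in>A. \<Sum>j\<in>A - {i}. G (A - {i}) * (t i * b i j)"
  have "2 * ?E = (\<Sum>i\<in>A. \<Sum>j\<in>A - {i}. G (A - {i}) * (t i * b i j) + G (A - {j}) * (t j * b j i))"
    unfolding mult_2 sum.distrib
    by (rule arg_cong2[where f = "(+)", OF refl sum_offdiag_swap[OF fin(1)]])
  also have "\<dots> = (\<Sum>i\<in>A. \<Sum>j\<in>A - {i}. G (A - {i}) + G (A - {j})
      + ((\<Sum>s\<in>S. x s * z s * (a i s * (a j s * G (A - {i} - {j})))) - x0 * G (A - {i} - {j})))"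
  proof (intro sum.cong refl)
    fix i j assume i: "i \<in> A" and j: "j \<in> A - {i}"
    have "G (A - {i}) * (t i * b i j) + G (A - {j}) * (t j * b j i) =
       G (A - {i} - {j}) * (t i * b i j * g j + t j * b j i * g i)"
      by (simp only: G1[OF j] G2[OF j i]) (simp add: algebra_simps)
    also have "\<dots> = G (A - {i} - {j}) * (g i + g j - x0 + (\<Sum>s\<in>S. x s * z s * (a i s * a j s)))"
      using i j by (subst exchange_identity) auto
    also have "\<dots> = g j * G (A - {i} - {j}) + g i * G (A - {i} - {j})
      + ((\<Sum>s\<in>S. x s * z s * (a i s * (a j s * G (A - {i} - {j})))) - x0 * G (A - {i} - {j}))"
      by (simp add: algebra_simps sum_distrib_left)
    finally show "G (A - {i}) * (t i * b i j) + G (A - {j}) * (t j * b j i) = 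
      G (A - {i}) + G (A - {j})
      + ((\<Sum>s\<in>S. x s * z s * (a i s * (a j s * G (A - {i} - {j})))) - x0 * G (A - {i} - {j}))"
      by (simp only: G1[OF j] G2[OF j i])
  qed
  also have "\<dots> = 2 * (\<Sum>i\<in>A. \<Sum>j\<in>A - {i}. G (A - {i}))
      + ((\<Sum>i\<in>A. \<Sum>j\<in>A - {i}. \<Sum>s\<in>S. x s * z s * (a i s * (a j s * G (A - {i} - {j}))))
        - x0 * (\<Sum>i\<in>A. \<Sum>j\<in>A - {i}. G (A - {i} - {j})))"
    by (simp only: sum.distrib sum_subtractf sum_distrib_left[of x0] mult_2
        sum_offdiag_swap[OF fin(1), of "\<lambda>i j. G (A - {j})"])
  also have "(\<Sum>i\<in>A. \<Sum>j\<in>A - {i}. G (A - {i})) = (of_nat (card A) - 1) * ?D"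
  proof -
    have "of_nat (card (A - {i})) = (of_nat (card A) - 1 :: 'a)" if "i \<in> A" for i
    proof -
      have "card A = Suc (card (A - {i}))" by (rule card.remove[OF fin(1) that, THEN trans]) simp
      then show ?thesis by simp
    qed
    then show ?thesis by (simp add: sum_distrib_left)
  qed
  also have "(\<Sum>i\<in>A. \<Sum>j\<in>A - {i}. \<Sum>s\<in>S. x s * z s * (a i s * (a j s * G (A - {i} - {j})))) =
     (\<Sum>s\<in>S. x s * z s * (\<Sum>i\<in>A. \<Sum>j\<in>A - {i}. a i s * (a j s * G (A - {i} - {j}))))"
  proof -
    have "(\<Sum>i\<in>A. \<Sum>j\<in>A - {i}. \<Sum>s\<in>S. x s * z s * (a i s * (a j s * G (A - {i} - {j})))) =
      (\<Sum>i\<in>A. \<Sum>s\<in>S. \<Sum>j\<in>A - {i}. x s * z s * (a i s * (a j s * G (A - {i} - {j}))))"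
      by (intro sum.cong refl sum.swap)
    also have "\<dots> = (\<Sum>s\<in>S. \<Sum>i\<in>A. \<Sum>j\<in>A - {i}. x s * z s * (a i s * (a j s * G (A - {i} - {j}))))"
      by (rule sum.swap)
    finally show ?thesis by (simp only: sum_distrib_left)
  qed
  finally have 2: "2 * ?E = 2 * ((of_nat (card A) - 1) * ?D) +
      ((\<Sum>s\<in>S. x s * z s * (\<Sum>i\<in>A. \<Sum>j\<in>A - {i}. a i s * (a j s * G (A - {i} - {j}))))
        - x0 * (\<Sum>i\<in>A. \<Sum>j\<in>A - {i}. G (A - {i} - {j})))" .
  have "(\<Sum>i\<in>A. G (A - {i}) *
           (1 + (\<Sum>s\<in>S. M s * (t i * a i s)) + M0 * (\<Sum>j\<in>A - {i}. t i * b i j))) =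
     ?D + (\<Sum>i\<in>A. G (A - {i}) * (\<Sum>s\<in>S. M s * (t i * a i s))) + M0 * ?E"
    by (simp only: distrib_left sum.distrib sum_distrib_left mult_1_right mult_1_left mult_ac)
  then have "2 * (\<Sum>i\<in>A. G (A - {i}) *
           (1 + (\<Sum>s\<in>S. M s * (t i * a i s)) + M0 * (\<Sum>j\<in>A - {i}. t i * b i j))) =
     2 * ?D + 2 * (\<Sum>i\<in>A. G (A - {i}) * (\<Sum>s\<in>S. M s * (t i * a i s))) + M0 * (2 * ?E)"
    by (simp only: distrib_left mult.left_commute[of 2 M0])
  then show ?thesis
    unfolding 1 2 by (simp only: distrib_left distrib_right right_diff_distrib mult_1_right mult_1_left mult.assoc mult.commute[of M0] mult.left_commute[of M0] add.assoc add.left_commute)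
qed

end

section \<open>Weight functions as coefficients of a product of linear forms\<close>

abbreviation (input) linform :: "nat set \<Rightarrow> (nat \<Rightarrow> nat \<Rightarrow> 'a::comm_ring_1) \<Rightarrow> nat \<Rightarrow> 'a mpoly" where
  "linform T u i \<equiv> (\<Sum>s\<in>T. const (u i s) * var s)"

lemma pd_linform: "finite T \<Longrightarrow> s \<in> T \<Longrightarrow> pd s (linform T u i) = const (u i s)"
  by (simp add: pd.sum pd.mult pd_var if_distrib[of "\<lambda>y. _ * y"] cong: if_cong)

lemma pd_prod_linform:
  assumes "finite A" "finite T" "s \<in> T"
  shows "pd s (\<Prod>i\<in>A. linform T u i) = (\<Sum>i\<in>A. const (u i s) * (\<Prod>j\<in>A - {i}. linform T u j))"
  using assms by (simp only: pd.prod pd_linform)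

lemma pd_pd_prod_linform:
  assumes "finite A" "finite T" "s \<in> T"
  shows "pd s (pd s (\<Prod>i\<in>A. linform T u i)) =
    (\<Sum>i\<in>A. \<Sum>j\<in>A - {i}. const (u i s) * (const (u j s) * (\<Prod>j\<in>A - {i} - {j}. linform T u j)))"
  using assms
  by (simp only: pd_prod_linform pd.sum pd.mult pd_const finite_Diff mult_zero_left add_0_left sum_distrib_left)

text \<open>
  A permanent whose columns \<open>j\<close> are repeated according to \<open>pos\<close> is, up to the factorials counting the
  permutations of equal columns, a coefficient of a product of linear forms. The induction expands the
  permanent along one column; on the other side this is the product rule for \<open>\<partial>\<^sub>s\<close>, which supplies the
  new factor of the factorial.
\<close>

lemma permanent_eq_lookup:
  fixes u :: "nat \<Rightarrow> nat \<Rightarrow> 'a::comm_ring_1"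
  assumes "finite A" "finite T" "pos ` A \<subseteq> T"
  shows "(\<Sum>\<sigma> | \<sigma> permutes A. \<Prod>j\<in>A. u (\<sigma> j) (pos j)) =
    (\<Prod>s\<in>T. of_nat (fact (card {j\<in>A. pos j = s}))) *
      Poly_Mapping.lookup (\<Prod>i\<in>A. linform T u i) (\<Sum>j\<in>A. Poly_Mapping.single (pos j) 1)"
  using assms(1,3)
proof (induction A arbitrary: u rule: finite_induct)
  case empty
  show ?case by (simp add: lookup_one)
next
  case (insert a B)
  let ?s = "pos a" and ?e = "\<Sum>j\<in>B. Poly_Mapping.single (pos j) (1::nat)"
  let ?F = "\<lambda>B. \<Prod>s\<in>T. (of_nat (fact (card {j\<in>B. pos j = s})) :: 'a)"
  have le: "Poly_Mapping.lookup ?e ?s = card {j\<in>B. pos j = ?s}"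
    using insert.hyps by (simp add: lookup_sum lookup_single when_def sum.If_cases Int_def)
  have F: "?F (insert a B) = of_nat (Poly_Mapping.lookup ?e ?s + 1) * ?F B"
  proof -
    have "{j \<in> insert a B. pos j = s} = {j \<in> B. pos j = s}" if "s \<noteq> ?s" for s
      using that by auto
    moreover have "{j \<in> insert a B. pos j = ?s} = insert a {j \<in> B. pos j = ?s}" by auto
    moreover have "?s \<in> T" using insert by auto
    ultimately show ?thesis
      unfolding le using assms(2) insert.hyps
      by (simp add: prod.remove[of T ?s] algebra_simps)
  qed
  have IH: "(\<Sum>q | q permutes B. \<Prod>j\<in>insert a B. u ((transpose a i \<circ> q) j) (pos j)) =
     u i ?s * (?F B * Poly_Mapping.lookup (\<Prod>i\<in>insert a B - {i}. linform T u i) ?e)"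
    if i: "i \<in> insert a B" for i
  proof -
    \<comment> \<open>Row \<open>i\<close> is used by column \<open>a\<close>; renaming row \<open>a\<close> to \<open>i\<close> indexes the remaining rows by \<open>B\<close> again.\<close>
    let ?u = "\<lambda>j. u (transpose a i j)"
    have "(\<Sum>q | q permutes B. \<Prod>j\<in>insert a B. u ((transpose a i \<circ> q) j) (pos j)) =
      (\<Sum>q | q permutes B. u i ?s * (\<Prod>j\<in>B. ?u (q j) (pos j)))"
      using insert.hyps by (intro sum.cong refl) (auto simp: permutes_def)
    also have "\<dots> = u i ?s * (\<Sum>q | q permutes B. (\<Prod>j\<in>B. ?u (q j) (pos j)))"
      by (simp add: sum_distrib_left)
    also have "(\<Sum>q | q permutes B. (\<Prod>j\<in>B. ?u (q j) (pos j))) =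
       ?F B * Poly_Mapping.lookup (\<Prod>i\<in>B. linform T ?u i) ?e"
      using insert.prems by (intro insert.IH) auto
    also have "(\<Prod>i\<in>B. linform T ?u i) = (\<Prod>j\<in>insert a B - {i}. linform T u j)"
    proof (rule prod.reindex_bij_betw)
      have "transpose a i ` B = insert a B - {i}"
        using i insert.hyps by (auto simp: transpose_def image_iff)
      then show "bij_betw (transpose a i) B (insert a B - {i})"
        by (metis bij_betw_def inj_on_transpose)
    qed
    finally show ?thesis .
  qed
  have "(\<Sum>\<sigma> | \<sigma> permutes insert a B. \<Prod>j\<in>insert a B. u (\<sigma> j) (pos j)) =
     (\<Sum>i\<in>insert a B. \<Sum>q | q permutes B. \<Prod>j\<in>insert a B. u ((transpose a i \<circ> q) j) (pos j))"
    using insert.hyps by (rule sum_over_permutations_insert)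
  also have "\<dots> = (\<Sum>i\<in>insert a B. u i ?s * (?F B * Poly_Mapping.lookup (\<Prod>i\<in>insert a B - {i}. linform T u i) ?e))"
    by (intro sum.cong refl IH)
  also have "\<dots> = ?F B * Poly_Mapping.lookup (pd ?s (\<Prod>i\<in>insert a B. linform T u i)) ?e"
    using insert assms(2)
    by (subst pd_prod_linform) (auto simp: lookup_sum lookup_const_times sum_distrib_left mult_ac simp del: prod.insert_remove sum.insert sum.insert_remove)
  also have "\<dots> = ?F (insert a B) * Poly_Mapping.lookup (\<Prod>i\<in>insert a B. linform T u i) (\<Sum>j\<in>insert a B. Poly_Mapping.single (pos j) 1)"
    unfolding lookup_pd F using insert.hyps by (simp add: mult_ac add_ac)
  finally show ?case .
qed

text \<open>
  \<open>pos j\<close> is the block containing \<open>j\<close> when \<open>1, 2, \<dots>\<close> are cut into consecutive blocks of lengths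
  \<open>J 1, J 2, \<dots>\<close>; it turns the double product in a weight function into a product over single variables.
\<close>

lemma block_positions:
  fixes J :: "nat \<Rightarrow> nat"
  shows "\<exists>pos. pos ` {1..(\<Sum>s\<in>{1..n}. J s)} \<subseteq> {1..n} \<and>
    (\<forall>s\<in>{1..n}. card {j \<in> {1..(\<Sum>s\<in>{1..n}. J s)}. pos j = s} = J s) \<and>
    (\<forall>f :: nat \<Rightarrow> nat \<Rightarrow> 'a::comm_monoid_mult.
      (\<Prod>s\<in>{1..n}. \<Prod>i\<in>{1..J s}. f ((\<Sum>r\<in>{1..<s}. J r) + i) s) =
      (\<Prod>j\<in>{1..(\<Sum>s\<in>{1..n}. J s)}. f j (pos j)))"
proof (induction n)
    case (Suc n)
    let ?N = "\<Sum>s\<in>{1..n}. J s" and ?N' = "\<Sum>s\<in>{1..Suc n}. J s"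
    from Suc obtain pos where pos: "pos ` {1..?N} \<subseteq> {1..n}"
      and card: "\<And>s. s \<in> {1..n} \<Longrightarrow> card {j \<in> {1..?N}. pos j = s} = J s"
      and prod: "\<And>f :: nat \<Rightarrow> nat \<Rightarrow> 'a.
      (\<Prod>s\<in>{1..n}. \<Prod>i\<in>{1..J s}. f ((\<Sum>r\<in>{1..<s}. J r) + i) s) = (\<Prod>j\<in>{1..?N}. f j (pos j))"
      by auto
    define pos' where "pos' j = (if j \<le> ?N then pos j else Suc n)" for j
    have N': "?N' = ?N + J (Suc n)" by simp
    have split: "{1..?N'} = {1..?N} \<union> {?N + 1..?N + J (Suc n)}" unfolding N' by auto
    have block: "bij_betw (\<lambda>i. ?N + i) {1..J (Suc n)} {?N + 1..?N + J (Suc n)}"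
      by (rule bij_betwI[of _ _ _ "\<lambda>i. i - ?N"]) auto
    have "pos' ` {1..?N'} \<subseteq> {1..Suc n}"
      using pos by (force simp: pos'_def)
    moreover have "card {j \<in> {1..?N'}. pos' j = s} = J s" if s: "s \<in> {1..Suc n}" for s
    proof (cases "s = Suc n")
      case True
      then have "{j \<in> {1..?N'}. pos' j = s} = {?N + 1..?N + J (Suc n)}"
        using pos unfolding split by (force simp: pos'_def)
      then show ?thesis using True by simp
    next
      case False
      then have "{j \<in> {1..?N'}. pos' j = s} = {j \<in> {1..?N}. pos j = s}"
        unfolding split by (auto simp: pos'_def)
      then show ?thesis using card[of s] s False by simp
    qed
    moreover have "(\<Prod>s\<in>{1..Suc n}. \<Prod>i\<in>{1..J s}. f ((\<Sum>r\<in>{1..<s}. J r) + i) s) =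
        (\<Prod>j\<in>{1..?N'}. f j (pos' j))" for f :: "nat \<Rightarrow> nat \<Rightarrow> 'a"
    proof -
      have "(\<Prod>j\<in>{1..?N'}. f j (pos' j)) =
          (\<Prod>j\<in>{1..?N}. f j (pos' j)) * (\<Prod>j\<in>{?N + 1..?N + J (Suc n)}. f j (pos' j))"
        unfolding split by (rule prod.union_disjoint) auto
      also have "(\<Prod>j\<in>{1..?N}. f j (pos' j)) = (\<Prod>j\<in>{1..?N}. f j (pos j))"
        by (intro prod.cong) (auto simp: pos'_def)
      also have "(\<Prod>j\<in>{?N + 1..?N + J (Suc n)}. f j (pos' j)) = (\<Prod>i\<in>{1..J (Suc n)}. f (?N + i) (pos' (?N + i)))"
        by (rule prod.reindex_bij_betw[OF block, symmetric])
      also have "\<dots> = (\<Prod>i\<in>{1..J (Suc n)}. f (?N + i) (Suc n))"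
        by (intro prod.cong) (auto simp: pos'_def)
      finally show ?thesis
        using prod[of f] by (simp add: atLeastLessThanSuc_atLeastAtMost)
    qed
    ultimately show ?case by blast
qed simp

text \<open>
  The linear forms range over \<open>{0..n}\<close> although no pole is attached to \<open>0\<close>: the exponent of the variable
  \<open>x\<^sub>0\<close> counts the \<open>t\<^sub>i\<close> that are left out of the weight function, and weight functions themselves are the
  coefficients in which \<open>x\<^sub>0\<close> does not occur.
\<close>

lemma weight_fun_eq_lookup:
  fixes t z :: "nat \<Rightarrow> 'a::field"
  assumes char0: "\<And>r. r > 0 \<Longrightarrow> of_nat r \<noteq> (0::'a)"
    and J: "(\<Sum>s\<in>{1..n}. J s) = k" and u: "\<And>i s. s \<in> {1..n} \<Longrightarrow> u i s = 1 / (t i - z s)"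
  shows "weight_fun k n J t z =
    Poly_Mapping.lookup (\<Prod>i\<in>{1..k}. linform {0..n} u i) (\<Sum>s\<in>{1..n}. Poly_Mapping.single s (J s))"
proof -
  obtain pos where pos: "pos ` {1..k} \<subseteq> {1..n}"
    and card: "\<And>s. s \<in> {1..n} \<Longrightarrow> card {j \<in> {1..k}. pos j = s} = J s"
    and prod: "\<And>f :: nat \<Rightarrow> nat \<Rightarrow> 'a.
      (\<Prod>s\<in>{1..n}. \<Prod>i\<in>{1..J s}. f ((\<Sum>r\<in>{1..<s}. J r) + i) s) = (\<Prod>j\<in>{1..k}. f j (pos j))"
    using block_positions[where n = n and J = J and 'a = 'a, unfolded J] by auto
  have e: "(\<Sum>j\<in>{1..k}. Poly_Mapping.single (pos j) 1) = (\<Sum>s\<in>{1..n}. Poly_Mapping.single s (J s))"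
  proof (intro poly_mapping_eqI)
    fix s
    have "Poly_Mapping.lookup (\<Sum>j\<in>{1..k}. Poly_Mapping.single (pos j) 1) s = card {j \<in> {1..k}. pos j = s}"
      by (simp add: lookup_sum lookup_single when_def sum.If_cases Int_def)
    also have "\<dots> = (if s \<in> {1..n} then J s else 0)"
    proof (cases "s \<in> {1..n}")
      case False
      then have "{j \<in> {1..k}. pos j = s} = {}" using pos by blast
      with False show ?thesis by (simp only: card.empty if_False)
    qed (simp only: card if_True)
    finally show "Poly_Mapping.lookup (\<Sum>j\<in>{1..k}. Poly_Mapping.single (pos j) 1) s =
        Poly_Mapping.lookup (\<Sum>s\<in>{1..n}. Poly_Mapping.single s (J s)) s"
      by (simp add: lookup_sum lookup_single when_def)
  qed
  define N where "N s = card {j \<in> {1..k}. pos j = s}" for s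
  have "{j \<in> {1..k}. pos j = 0} = {}" using pos by force
  then have "N 0 = 0" unfolding N_def by (simp only: card.empty)
  moreover have "N s = J s" if "s \<in> {1..n}" for s
    using card[OF that] by (simp only: N_def)
  ultimately have F: "(\<Prod>s\<in>{0..n}. of_nat (fact (N s))) = (\<Prod>s\<in>{1..n}. of_nat (fact (J s)) :: 'a)"
    by (simp add: prod.atLeast_Suc_atMost)
  have "Sym k (\<lambda>t. \<Prod>s\<in>{1..n}. \<Prod>i\<in>{1..J s}. 1 / (t ((\<Sum>r\<in>{1..<s}. J r) + i) - z s)) t =
      (\<Sum>\<sigma> | \<sigma> permutes {1..k}. \<Prod>j\<in>{1..k}. 1 / (t (\<sigma> j) - z (pos j)))"
    unfolding Sym_def
    by (intro sum.cong refl) (rule prod[of "\<lambda>j s. 1 / (t (_ j) - z s)"])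
  also have "\<dots> = (\<Sum>\<sigma> | \<sigma> permutes {1..k}. \<Prod>j\<in>{1..k}. u (\<sigma> j) (pos j))"
    using pos by (intro sum.cong prod.cong refl u[symmetric]) blast
  also have "\<dots> = (\<Prod>s\<in>{0..n}. of_nat (fact (card {j \<in> {1..k}. pos j = s}))) *
      Poly_Mapping.lookup (\<Prod>i\<in>{1..k}. linform {0..n} u i) (\<Sum>j\<in>{1..k}. Poly_Mapping.single (pos j) 1)"
    using pos by (intro permanent_eq_lookup) force+
  finally show ?thesis
    unfolding weight_fun_def e N_def[symmetric] F using char0 by (simp del: of_nat_fact)
qed

section \<open>The master polynomial and its weighted coefficients\<close>

interpretation to_fract: comm_ring_hom "to_fract :: 'a::idom \<Rightarrow> 'a fract"
  by unfold_locales simp_all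

text \<open>
  Logarithmic derivatives are recorded as a relation: \<open>d\<close> acts on the integral domain only, while the
  quotient \<open>d f / f\<close> lives in its fraction field.
\<close>

definition log_deriv :: "('a::idom \<Rightarrow> 'a) \<Rightarrow> 'a \<Rightarrow> 'a fract \<Rightarrow> bool" where
  "log_deriv d f y \<longleftrightarrow> to_fract (d f) = to_fract f * y"

lemma log_deriv_const: "d f = 0 \<Longrightarrow> log_deriv d f 0"
  by (simp add: log_deriv_def)

lemma log_deriv_mult:
  assumes "derivation d" "log_deriv d f y" "log_deriv d f' y'"
  shows "log_deriv d (f * f') (y + y')"
  using assms by (simp add: log_deriv_def derivation.mult algebra_simps)

lemma log_deriv_prod:
  assumes "derivation d" "\<And>i. i \<in> A \<Longrightarrow> log_deriv d (f i) (y i)"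
  shows "log_deriv d (\<Prod>i\<in>A. f i) (\<Sum>i\<in>A. y i)"
  using assms
  by (induction A rule: infinite_finite_induct)
    (auto intro!: log_deriv_const log_deriv_mult derivation.one)

lemma log_deriv_power:
  assumes "derivation d" "log_deriv d f y"
  shows "log_deriv d (f ^ r) (of_nat r * y)"
  using log_deriv_prod[OF assms(1), of "{..<r}" "\<lambda>_. f" "\<lambda>_. y"] assms(2) by simp

lemma of_nat_fract_nonzero: "r > 0 \<Longrightarrow> of_nat r \<noteq> (0 :: int mpoly mpoly fract)"
  by (simp add: to_fract.hom_of_nat[symmetric] del: to_fract.hom_of_nat)

lemma var_minus_const_nonzero: "var i - const a \<noteq> (0 :: 'a::comm_ring_1 mpoly)"
proof
  assume "var i - const a = 0"
  then have "pd i (var i - const a) = 0" by simp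
  then show False by (simp add: pd.diff pd_var)
qed

lemma var_minus_var_nonzero: "i \<noteq> j \<Longrightarrow> var i - var j \<noteq> (0 :: 'a::comm_ring_1 mpoly)"
proof
  assume "i \<noteq> j" "var i - var j = (0 :: 'a mpoly)"
  then have "pd i (var i - var j :: 'a mpoly) = 0" by simp
  then show False using \<open>i \<noteq> j\<close> by (simp add: pd.diff pd_var)
qed

locale master_data =
  fixes k n :: nat and M :: "nat \<Rightarrow> nat" and M2 :: "nat \<Rightarrow> nat \<Rightarrow> nat" and M0 :: nat
  assumes M_pos: "s \<in> {1..n} \<Longrightarrow> M s > 0"
begin

abbreviation T :: "nat \<Rightarrow> int mpoly mpoly" where "T \<equiv> var"
abbreviation Z :: "nat \<Rightarrow> int mpoly mpoly" where "Z s \<equiv> const (var s)"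
abbreviation t :: "nat \<Rightarrow> int mpoly mpoly fract" where "t i \<equiv> to_fract (T i)"
abbreviation z :: "nat \<Rightarrow> int mpoly mpoly fract" where "z s \<equiv> to_fract (Z s)"

text \<open>The coefficients of the linear forms; the value at \<open>0\<close> belongs to the variable \<open>x\<^sub>0\<close>.\<close>

definition u :: "nat \<Rightarrow> nat \<Rightarrow> int mpoly mpoly fract" where
  "u i s = (if s = 0 then 1 else 1 / (t i - z s))"

text \<open>
  The factor \<open>\<Prod>\<^sub>r (t\<^sub>i - z\<^sub>r)\<^bsup>M\<^sub>r\<^esup>\<close> of the master polynomial, times \<open>u i s\<close>. Since every \<open>M\<^sub>s\<close> is positive
  the pole is absorbed, and the product with \<open>u\<close> is again a polynomial.
\<close>

definition h :: "nat \<Rightarrow> nat \<Rightarrow> int mpoly mpoly" where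
  "h i s = (\<Prod>r\<in>{1..n}. (T i - Z r) ^ (M r - of_bool (r = s)))"

definition pref :: "int mpoly mpoly" where
  "pref = (\<Prod>i\<in>{1..n}. \<Prod>j\<in>{i<..n}. (Z i - Z j) ^ M2 i j) *
     (\<Prod>i\<in>{1..k}. \<Prod>j\<in>{i<..k}. (T i - T j) ^ M0)"

text \<open>
  The integral form of \<open>\<Phi>\<close> times a coefficient of \<open>\<Prod>\<^sub>i (x\<^sub>0 + \<Sum>\<^sub>s x\<^sub>s / (t\<^sub>i - z\<^sub>s))\<close>.
\<close>

definition P :: "(nat \<Rightarrow>\<^sub>0 nat) \<Rightarrow> int mpoly mpoly" where
  "P c = pref * Poly_Mapping.lookup (\<Prod>i\<in>{1..k}. linform {0..n} h i) c"

definition Phi :: "int mpoly mpoly fract" where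
  "Phi = to_fract (pref * (\<Prod>i\<in>{1..k}. h i 0))"

lemma t_minus_z_nonzero: "t i - z s \<noteq> 0"
  using var_minus_const_nonzero[of i "var s :: int mpoly"] by (simp flip: to_fract_diff)

lemma t_minus_t_nonzero: "i \<noteq> j \<Longrightarrow> t i - t j \<noteq> 0"
  using var_minus_var_nonzero[of i j, where 'a = "int mpoly"] by (simp flip: to_fract_diff)

lemma to_fract_h:
  assumes "s \<in> {0..n}"
  shows "to_fract (h i s) = to_fract (h i 0) * u i s"
proof (cases "s = 0")
  case True
  then show ?thesis by (simp add: u_def)
next
  case False
  then have s: "s \<in> {1..n}" using assms by auto
  have "h i 0 = (T i - Z s) ^ M s * (\<Prod>r\<in>{1..n} - {s}. (T i - Z r) ^ M r)"
    unfolding h_def using s by (subst prod.remove[of _ s]) auto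
  also have "(T i - Z s) ^ M s = (T i - Z s) * (T i - Z s) ^ (M s - 1)"
    using M_pos[OF s] by (metis power_minus_mult mult.commute)
  finally have "h i 0 = (T i - Z s) * ((T i - Z s) ^ (M s - 1) * (\<Prod>r\<in>{1..n} - {s}. (T i - Z r) ^ M r))"
    by (simp only: mult.assoc)
  also have "(T i - Z s) ^ (M s - 1) * (\<Prod>r\<in>{1..n} - {s}. (T i - Z r) ^ M r) = h i s"
    unfolding h_def using s by (subst prod.remove[of _ s]) auto
  finally show ?thesis
    using t_minus_z_nonzero[of i s] False by (simp add: u_def)
qed

lemma to_fract_lookup_prod:
  "to_fract (Poly_Mapping.lookup (\<Prod>i\<in>B. linform {0..n} h i) c) =
     to_fract (\<Prod>i\<in>B. h i 0) * Poly_Mapping.lookup (\<Prod>i\<in>B. linform {0..n} u i) c"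
proof -
  interpret map: comm_ring_hom "Poly_Mapping.map to_fract :: int mpoly mpoly mpoly \<Rightarrow> _"
    by (rule to_fract.map_mpoly_hom)
  have 1: "Poly_Mapping.map to_fract (linform {0..n} h i) = const (to_fract (h i 0)) * linform {0..n} u i" for i
  proof -
    have "Poly_Mapping.map to_fract (linform {0..n} h i) = (\<Sum>s\<in>{0..n}. const (to_fract (h i s)) * var s)"
      by (simp only: map.hom_sum map.hom_mult to_fract.map_mpoly_const to_fract.map_mpoly_var)
    also have "\<dots> = (\<Sum>s\<in>{0..n}. const (to_fract (h i 0)) * (const (u i s) * var s))"
      by (intro sum.cong refl) (simp only: to_fract_h const_mult mult.assoc)
    finally show ?thesis by (simp only: sum_distrib_left)
  qed
  have "to_fract (Poly_Mapping.lookup (\<Prod>i\<in>B. linform {0..n} h i) c) =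
      Poly_Mapping.lookup (Poly_Mapping.map to_fract (\<Prod>i\<in>B. linform {0..n} h i)) c"
    by (simp only: lookup_map_zero[of to_fract, OF to_fract_0])
  also have "\<dots> = Poly_Mapping.lookup (const (to_fract (\<Prod>i\<in>B. h i 0)) * (\<Prod>i\<in>B. linform {0..n} u i)) c"
    by (simp only: map.hom_prod 1 prod.distrib const_hom.hom_prod to_fract.hom_prod)
  finally show ?thesis by (simp only: lookup_const_times)
qed

lemma to_fract_P: "to_fract (P c) = Phi * Poly_Mapping.lookup (\<Prod>i\<in>{1..k}. linform {0..n} u i) c"
  unfolding P_def Phi_def by (simp only: to_fract_mult to_fract_lookup_prod mult.assoc)

lemma Phi_eq_master_poly: "Phi = master_poly k n M M2 M0 t z"
proof -
  have "to_fract (\<Prod>i\<in>{1..k}. h i 0) = (\<Prod>i\<in>{1..k}. \<Prod>s\<in>{1..n}. (t i - z s) ^ M s)"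
    unfolding h_def to_fract.hom_prod
    by (intro prod.cong refl) (simp add: to_fract.hom_power)
  also have "\<dots> = (\<Prod>s\<in>{1..n}. \<Prod>i\<in>{1..k}. (t i - z s) ^ M s)"
    by (rule prod.swap)
  finally show ?thesis
    unfolding Phi_def pref_def master_poly_def
    by (simp only: to_fract_mult to_fract.hom_prod to_fract.hom_power to_fract_diff)
qed

lemma master_weight_eq:
  assumes "(\<Sum>s\<in>{1..n}. J s) = k"
  shows "master_weight k n M M2 M0 J = P (\<Sum>s\<in>{1..n}. Poly_Mapping.single s (J s))"
proof -
  have "weight_fun k n J t z =
      Poly_Mapping.lookup (\<Prod>i\<in>{1..k}. linform {0..n} u i) (\<Sum>s\<in>{1..n}. Poly_Mapping.single s (J s))"
    using assms by (intro weight_fun_eq_lookup of_nat_fract_nonzero) (auto simp: u_def)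
  then have "master_poly k n M M2 M0 t z * weight_fun k n J t z =
      to_fract (P (\<Sum>s\<in>{1..n}. Poly_Mapping.single s (J s)))"
    by (simp only: to_fract_P Phi_eq_master_poly)
  then show ?thesis
    unfolding master_weight_def Let_def to_fract_def[symmetric] by (simp only: to_fract_eq_iff the_eq_trivial)
qed

section \<open>The total derivative that carries the raising operator\<close>

text \<open>
  An integral form of \<open>t\<^sub>i \<Phi> G / g\<^sub>i\<close>. Omitting \<open>g\<^sub>i\<close> from the product means that \<open>t\<^sub>i\<close> occurs only in \<open>t\<^sub>i \<Phi>\<close>,
  so that \<open>\<partial>/\<partial>t\<^sub>i\<close> amounts to a logarithmic derivative of \<open>t\<^sub>i \<Phi>\<close>.
\<close>

definition Q :: "nat \<Rightarrow> (nat \<Rightarrow>\<^sub>0 nat) \<Rightarrow> int mpoly mpoly" where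
  "Q i c = T i * (pref * h i 0 * Poly_Mapping.lookup (\<Prod>j\<in>{1..k} - {i}. linform {0..n} h j) c)"

lemma pd_h:
  assumes "i \<noteq> j"
  shows "pd i (h j s) = 0"
proof -
  have "pd i ((T j - Z r) ^ e) = 0" for r e
    using pd.prod_const[of "{..<e}" i "\<lambda>_. T j - Z r"] assms by (simp add: pd.diff pd_var)
  then show ?thesis
    unfolding h_def by (intro pd.prod_const)
qed

lemma pd_lookup_prod:
  assumes "i \<notin> B"
  shows "pd i (Poly_Mapping.lookup (\<Prod>j\<in>B. linform {0..n} h j) c) = 0"
proof -
  interpret D: derivation "Poly_Mapping.map (pd i) :: int mpoly mpoly mpoly \<Rightarrow> _"
    by (rule pd.map_mpoly_derivation)
  have "Poly_Mapping.map (pd i) (\<Prod>j\<in>B. linform {0..n} h j) = 0"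
  proof (rule D.prod_const)
    fix j assume "j \<in> B"
    with assms have "i \<noteq> j" by auto
    then show "Poly_Mapping.map (pd i) (linform {0..n} h j) = 0"
      by (simp add: D.sum D.mult pd.map_mpoly_const pd.map_mpoly_var pd_h)
  qed
  then show ?thesis
    by (simp only: lookup_map_zero[of "pd i", OF pd.zero, symmetric] lookup_zero)
qed

lemma log_deriv_vandermonde:
  assumes "i \<in> {1..k}"
  shows "log_deriv (pd i) (\<Prod>a\<in>{1..k}. \<Prod>b\<in>{a<..k}. (T a - T b) ^ M0)
    (of_nat M0 * (\<Sum>j\<in>{1..k} - {i}. 1 / (t i - t j)))"
proof -
  let ?w = "\<lambda>a b. 1 / (t a - t b)"
  have ld: "log_deriv (pd i) (\<Prod>a\<in>{1..k}. \<Prod>b\<in>{a<..k}. (T a - T b) ^ M0)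
    (\<Sum>a\<in>{1..k}. \<Sum>b\<in>{a<..k}. of_nat M0 * ((of_bool (a = i) - of_bool (b = i)) * ?w a b))"
  proof (intro log_deriv_prod log_deriv_power pd.derivation_axioms)
    fix a b assume "b \<in> {a<..k}"
    then have "t a - t b \<noteq> 0" by (intro t_minus_t_nonzero) auto
    then have "(of_bool (a = i) - of_bool (b = i)) = (t a - t b) * ((of_bool (a = i) - of_bool (b = i)) * ?w a b)"
      by (simp del: to_fract_diff)
    moreover have "to_fract (pd i (T a - T b)) = of_bool (a = i) - of_bool (b = i)"
      by (simp add: pd.diff pd_var)
    ultimately show "log_deriv (pd i) (T a - T b) ((of_bool (a = i) - of_bool (b = i)) * ?w a b)"
      by (simp only: log_deriv_def to_fract_diff)
  qed
  have e1: "(\<Sum>a\<in>{1..k}. \<Sum>b\<in>{a<..k}. of_bool (a = i) * ?w a b) = (\<Sum>b\<in>{i<..k}. ?w i b)"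
  proof -
    have "(\<Sum>a\<in>{1..k}. \<Sum>b\<in>{a<..k}. of_bool (a = i) * ?w a b) =
        (\<Sum>a\<in>{1..k}. if a = i then \<Sum>b\<in>{a<..k}. ?w a b else 0)"
      by (intro sum.cong refl) simp
    then show ?thesis using assms by simp
  qed
  have e2: "(\<Sum>a\<in>{1..k}. \<Sum>b\<in>{a<..k}. of_bool (b = i) * ?w a b) = - (\<Sum>a\<in>{1..<i}. ?w i a)"
  proof -
    have "(\<Sum>b\<in>{a<..k}. of_bool (b = i) * ?w a b) = (if a \<in> {1..<i} then ?w a i else 0)"
      if "a \<in> {1..k}" for a
    proof -
      have "(\<Sum>b\<in>{a<..k}. of_bool (b = i) * ?w a b) = (\<Sum>b\<in>{a<..k}. if b = i then ?w a b else 0)"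
        by (intro sum.cong refl) simp
      then show ?thesis using assms that by simp
    qed
    then have "(\<Sum>a\<in>{1..k}. \<Sum>b\<in>{a<..k}. of_bool (b = i) * ?w a b) =
        (\<Sum>a\<in>{1..k}. if a \<in> {1..<i} then ?w a i else 0)"
      by (intro sum.cong refl)
    also have "\<dots> = (\<Sum>a\<in>{1..k} \<inter> {1..<i}. ?w a i)"
      by (rule sum.inter_restrict[symmetric]) simp
    also have "\<dots> = (\<Sum>a\<in>{1..<i}. - ?w i a)"
      using assms by (intro sum.cong) (auto simp only: minus_divide_right minus_diff_eq atLeastAtMost_iff atLeastLessThan_iff Int_iff)
    finally show ?thesis by (simp only: sum_negf)
  qed
  have e3: "(\<Sum>b\<in>{i<..k}. ?w i b) - - (\<Sum>a\<in>{1..<i}. ?w i a) = (\<Sum>j\<in>{1..k} - {i}. ?w i j)"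
  proof -
    have "{1..k} - {i} = {i<..k} \<union> {1..<i}" "{i<..k} \<inter> {1..<i} = {}" using assms by auto
    then show ?thesis
      by (simp only: sum.union_disjoint[OF finite_greaterThanAtMost finite_atLeastLessThan] diff_minus_eq_add)
  qed
  have "(\<Sum>a\<in>{1..k}. \<Sum>b\<in>{a<..k}. of_nat M0 * ((of_bool (a = i) - of_bool (b = i)) * ?w a b)) =
      of_nat M0 * ((\<Sum>a\<in>{1..k}. \<Sum>b\<in>{a<..k}. of_bool (a = i) * ?w a b)
        - (\<Sum>a\<in>{1..k}. \<Sum>b\<in>{a<..k}. of_bool (b = i) * ?w a b))"
    by (simp only: left_diff_distrib sum_subtractf sum_distrib_left right_diff_distrib)
  then show ?thesis
    using ld by (simp only: e1 e2 e3)
qed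

definition logd_Phi :: "nat \<Rightarrow> int mpoly mpoly fract" where
  "logd_Phi i = of_nat M0 * (\<Sum>j\<in>{1..k} - {i}. 1 / (t i - t j)) + (\<Sum>s\<in>{1..n}. of_nat (M s) * u i s)"

lemma to_fract_pd_Q:
  assumes i: "i \<in> {1..k}"
  shows "to_fract (pd i (Q i c)) =
    Phi * Poly_Mapping.lookup ((\<Prod>j\<in>{1..k} - {i}. linform {0..n} u j) * const (1 + t i * logd_Phi i)) c"
proof -
  let ?L = "Poly_Mapping.lookup (\<Prod>j\<in>{1..k} - {i}. linform {0..n} h j) c"
  have "log_deriv (pd i) (\<Prod>i\<in>{1..n}. \<Prod>j\<in>{i<..n}. (Z i - Z j) ^ M2 i j) 0"
  proof (intro log_deriv_const pd.prod_const)
    fix a b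
    show "pd i ((Z a - Z b) ^ M2 a b) = 0"
      using pd_const[of i "(var a - var b) ^ M2 a b :: int mpoly"]
      by (simp only: const_hom.hom_minus const_hom.hom_power)
  qed
  moreover have "log_deriv (pd i) (h i 0) (\<Sum>s\<in>{1..n}. of_nat (M s) * u i s)"
    unfolding h_def
  proof (intro log_deriv_prod pd.derivation_axioms)
    fix s assume s: "s \<in> {1..n}"
    have "log_deriv (pd i) (T i - Z s) (u i s)"
      using s t_minus_z_nonzero[of i s] by (simp add: log_deriv_def pd.diff pd_var u_def)
    from log_deriv_power[OF pd.derivation_axioms this, of "M s"] s
    show "log_deriv (pd i) ((T i - Z s) ^ (M s - of_bool (s = 0))) (of_nat (M s) * u i s)"
      by simp
  qed
  moreover have "log_deriv (pd i) ?L 0"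
    by (intro log_deriv_const pd_lookup_prod) simp
  ultimately have "log_deriv (pd i) (pref * h i 0 * ?L) (0 + of_nat M0 * (\<Sum>j\<in>{1..k} - {i}. 1 / (t i - t j))
      + (\<Sum>s\<in>{1..n}. of_nat (M s) * u i s) + 0)"
    unfolding pref_def using log_deriv_vandermonde[OF i]
    by (intro log_deriv_mult pd.derivation_axioms)
  then have ld: "to_fract (pd i (pref * h i 0 * ?L)) = to_fract (pref * h i 0 * ?L) * logd_Phi i"
    by (simp add: log_deriv_def logd_Phi_def)
  have "(\<Prod>j\<in>{1..k}. h j 0) = h i 0 * (\<Prod>j\<in>{1..k} - {i}. h j 0)"
    using i by (intro prod.remove) auto
  then have X: "to_fract (pref * h i 0 * ?L) = Phi * Poly_Mapping.lookup (\<Prod>j\<in>{1..k} - {i}. linform {0..n} u j) c"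
    by (simp only: Phi_def to_fract_mult to_fract_lookup_prod mult.assoc)
  have "pd i (Q i c) = pref * h i 0 * ?L + T i * pd i (pref * h i 0 * ?L)"
    unfolding Q_def pd.mult[of i "T i"] by (simp add: pd_var)
  then have "to_fract (pd i (Q i c)) = to_fract (pref * h i 0 * ?L) * (1 + t i * logd_Phi i)"
    by (simp only: to_fract_add to_fract_mult[of "T i"] ld) (simp only: distrib_left distrib_right mult_1_right mult_1_left mult_ac)
  also have "\<dots> = Phi * ((1 + t i * logd_Phi i) * Poly_Mapping.lookup (\<Prod>j\<in>{1..k} - {i}. linform {0..n} u j) c)"
    unfolding X by (simp only: mult_ac)
  also have "(1 + t i * logd_Phi i) * Poly_Mapping.lookup (\<Prod>j\<in>{1..k} - {i}. linform {0..n} u j) c =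
      Poly_Mapping.lookup ((\<Prod>j\<in>{1..k} - {i}. linform {0..n} u j) * const (1 + t i * logd_Phi i)) c"
    by (subst mult.commute[of _ "const _"]) (rule lookup_const_times[symmetric])
  finally show ?thesis .
qed

lemma generating_function_identity:
  defines "G \<equiv> \<Prod>i\<in>{1..k}. linform {0..n} u i"
  shows "2 * (\<Sum>i\<in>{1..k}. (\<Prod>j\<in>{1..k} - {i}. linform {0..n} u j) * const (1 + t i * logd_Phi i)) =
     2 * (1 + (\<Sum>s\<in>{1..n}. const (of_nat (M s))) + (of_nat k - 1) * const (of_nat M0)) * pd 0 G
     + 2 * (\<Sum>s\<in>{1..n}. const (of_nat (M s)) * const (z s) * pd s G)
     + const (of_nat M0) * ((\<Sum>s\<in>{1..n}. const (z s) * (var s * pd s (pd s G))) - var 0 * pd 0 (pd 0 G))"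
proof -
  interpret pts: points "{1..k}" "{1..n}" "\<lambda>i. const (t i)" "\<lambda>s. const (z s)" var "var 0"
    "\<lambda>i s. const (u i s)" "\<lambda>i j. const (1 / (t i - t j))"
  proof
    fix i s assume "i \<in> {1..k}" "s \<in> {1..n}"
    then show "(const (t i) - const (z s)) * const (u i s) = 1"
      using t_minus_z_nonzero[of i s]
      by (simp add: u_def del: to_fract_diff flip: const_hom.hom_minus const_mult)
  next
    fix i j :: nat assume "i \<noteq> j"
    then show "(const (t i) - const (t j)) * const (1 / (t i - t j)) = 1"
      using t_minus_t_nonzero[of i j]
      by (simp del: to_fract_diff flip: const_hom.hom_minus const_mult)
  qed auto
  have g: "pts.g i = linform {0..n} u i" for i
    unfolding pts.g_def by (simp add: sum.atLeast_Suc_atMost[of 0 n] u_def[of i 0] mult.commute)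
  have 0: "const (u i 0) = 1" for i by (simp add: u_def)
  have one: "pd s G = (\<Sum>i\<in>{1..k}. const (u i s) * (\<Prod>j\<in>{1..k} - {i}. linform {0..n} u j))"
    if "s \<in> {0..n}" for s
    unfolding G_def using that by (intro pd_prod_linform) auto
  have two: "pd s (pd s G) = (\<Sum>i\<in>{1..k}. \<Sum>j\<in>{1..k} - {i}.
      const (u i s) * (const (u j s) * (\<Prod>j\<in>{1..k} - {i} - {j}. linform {0..n} u j)))"
    if "s \<in> {0..n}" for s
    unfolding G_def using that by (intro pd_pd_prod_linform) auto
  have c: "const (1 + t i * logd_Phi i) = 1 + (\<Sum>s\<in>{1..n}. const (of_nat (M s)) * (const (t i) * const (u i s)))
      + const (of_nat M0) * (\<Sum>j\<in>{1..k} - {i}. const (t i) * const (1 / (t i - t j)))" for i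
    unfolding logd_Phi_def
    by (simp only: const_add const_mult const_1 const_hom.hom_sum distrib_left sum_distrib_left mult_ac add_ac)
  have S: "(\<Sum>s\<in>{1..n}. const (of_nat (M s)) * const (z s) * pd s G) =
     (\<Sum>s\<in>{1..n}. const (of_nat (M s)) * const (z s) * (\<Sum>i\<in>{1..k}. const (u i s) * (\<Prod>j\<in>{1..k} - {i}. linform {0..n} u j)))"
    by (intro sum.cong refl) (simp add: one)
  have S2: "(\<Sum>s\<in>{1..n}. const (z s) * (var s * pd s (pd s G))) =
     (\<Sum>s\<in>{1..n}. var s * const (z s) * (\<Sum>i\<in>{1..k}. \<Sum>j\<in>{1..k} - {i}.
      const (u i s) * (const (u j s) * (\<Prod>j\<in>{1..k} - {i} - {j}. linform {0..n} u j))))"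
    by (intro sum.cong refl) (simp add: two mult_ac)
  have Z1: "pd 0 G = (\<Sum>i\<in>{1..k}. (\<Prod>j\<in>{1..k} - {i}. linform {0..n} u j))"
    by (simp only: one[of 0] atLeastAtMost_iff le0 simp_thms 0 mult_1_left)
  have Z2: "pd 0 (pd 0 G) = (\<Sum>i\<in>{1..k}. \<Sum>j\<in>{1..k} - {i}. (\<Prod>j\<in>{1..k} - {i} - {j}. linform {0..n} u j))"
    by (simp only: two[of 0] atLeastAtMost_iff le0 simp_thms 0 mult_1_left)
  show ?thesis
    unfolding S S2 Z2 unfolding Z1 c
    using pts.core_identity[of "\<lambda>s. const (of_nat (M s))" "const (of_nat M0)", unfolded g]
    by (simp only: card_atLeastAtMost diff_Suc_1)
qed

text \<open>
  Comparing coefficients in the generating function identity. With \<open>2 M\<^sub>s \<equiv> -M\<^sup>0 m\<^sub>s\<close> modulo \<open>p\<close> the factor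
  at \<open>z\<^sub>s\<close> becomes \<open>-M\<^sup>0 (c\<^sub>s + 1) (m\<^sub>s - c\<^sub>s)\<close>, that is, \<open>-M\<^sup>0\<close> times the matrix entry of \<open>e\<close>; the remaining term raises the
  exponent of \<open>x\<^sub>0\<close>.
\<close>

lemma total_derivative:
  fixes c :: "nat \<Rightarrow>\<^sub>0 nat"
  defines "c0 \<equiv> Poly_Mapping.lookup c 0"
  shows "2 * (\<Sum>i\<in>{1..k}. pd i (Q i c)) =
    const (of_int ((int c0 + 1) * (2 * (1 + (\<Sum>s\<in>{1..n}. int (M s)) + (int k - 1) * int M0) - int M0 * int c0)))
      * P (c + Poly_Mapping.single 0 1)
    + (\<Sum>s\<in>{1..n}. const (var s * of_int ((int (Poly_Mapping.lookup c s) + 1) *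
        (2 * int (M s) + int M0 * int (Poly_Mapping.lookup c s)))) * P (c + Poly_Mapping.single s 1))"
    (is "_ = ?rhs")
proof -
  let ?G = "\<Prod>i\<in>{1..k}. linform {0..n} u i"
  let ?l = "\<lambda>f. Poly_Mapping.lookup f c" and ?X = "\<lambda>s. Poly_Mapping.lookup ?G (c + Poly_Mapping.single s 1)"
  let ?c = "\<lambda>s. of_nat (Poly_Mapping.lookup c s) :: int mpoly mpoly fract"
  have l: "?l (const a * f) = a * ?l f" for a :: "int mpoly mpoly fract" and f
    by (rule lookup_const_times)
  have l2: "?l (2 * f) = 2 * ?l f" for f :: "int mpoly mpoly fract mpoly"
    by (simp only: mult_2 lookup_add)
  have "to_fract (2 * (\<Sum>i\<in>{1..k}. pd i (Q i c))) = 2 * (\<Sum>i\<in>{1..k}. to_fract (pd i (Q i c)))"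
    by (simp only: mult_2 to_fract_add to_fract_sum)
  also have "\<dots> = 2 * (\<Sum>i\<in>{1..k}. Phi *
     Poly_Mapping.lookup ((\<Prod>j\<in>{1..k} - {i}. linform {0..n} u j) * const (1 + t i * logd_Phi i)) c)"
    by (intro arg_cong2[where f = "(*)"] sum.cong refl to_fract_pd_Q)
  also have "\<dots> = Phi * ?l (2 * (\<Sum>i\<in>{1..k}. (\<Prod>j\<in>{1..k} - {i}. linform {0..n} u j) * const (1 + t i * logd_Phi i)))"
    by (simp only: l2 lookup_sum sum_distrib_left[symmetric] mult_ac)
  also have "2 * (\<Sum>i\<in>{1..k}. (\<Prod>j\<in>{1..k} - {i}. linform {0..n} u j) * const (1 + t i * logd_Phi i)) =
     const (2 * (1 + (\<Sum>s\<in>{1..n}. of_nat (M s)) + (of_nat k - 1) * of_nat M0)) * pd 0 ?G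
     + (\<Sum>s\<in>{1..n}. const (2 * of_nat (M s) * z s) * pd s ?G)
     + const (of_nat M0) * ((\<Sum>s\<in>{1..n}. const (z s) * (var s * pd s (pd s ?G))) - var 0 * pd 0 (pd 0 ?G))"
    unfolding generating_function_identity
    by (simp only: const_hom.hom_mult const_hom.hom_add const_hom.hom_sum const_hom.hom_of_nat const_hom.hom_minus
        const_1 const_hom.hom_numeral sum_distrib_left mult.assoc)
  also have "?l \<dots> = 2 * (1 + (\<Sum>s\<in>{1..n}. of_nat (M s)) + (of_nat k - 1) * of_nat M0) * ((?c 0 + 1) * ?X 0)
     + (\<Sum>s\<in>{1..n}. 2 * of_nat (M s) * z s * ((?c s + 1) * ?X s))
     + of_nat M0 * ((\<Sum>s\<in>{1..n}. z s * (?c s * (?c s + 1) * ?X s)) - ?c 0 * (?c 0 + 1) * ?X 0)"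
    by (simp only: lookup_add lookup_minus lookup_sum l lookup_var_pd_pd lookup_pd of_nat_mult of_nat_add of_nat_1)
  also have "\<dots> = (?c 0 + 1) * (2 * (1 + (\<Sum>s\<in>{1..n}. of_nat (M s)) + (of_nat k - 1) * of_nat M0) - of_nat M0 * ?c 0) * ?X 0
     + ((\<Sum>s\<in>{1..n}. 2 * of_nat (M s) * z s * ((?c s + 1) * ?X s)) + of_nat M0 * (\<Sum>s\<in>{1..n}. z s * (?c s * (?c s + 1) * ?X s)))"
    by (simp add: algebra_simps)
  also have "(\<Sum>s\<in>{1..n}. 2 * of_nat (M s) * z s * ((?c s + 1) * ?X s)) + of_nat M0 * (\<Sum>s\<in>{1..n}. z s * (?c s * (?c s + 1) * ?X s))
    = (\<Sum>s\<in>{1..n}. z s * ((?c s + 1) * (2 * of_nat (M s) + of_nat M0 * ?c s)) * ?X s)"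
    unfolding sum_distrib_left sum.distrib[symmetric]
    by (intro sum.cong refl) (simp only: algebra_simps)
  finally have "to_fract (2 * (\<Sum>i\<in>{1..k}. pd i (Q i c))) =
      Phi * ((?c 0 + 1) * (2 * (1 + (\<Sum>s\<in>{1..n}. of_nat (M s)) + (of_nat k - 1) * of_nat M0) - of_nat M0 * ?c 0) * ?X 0
     + (\<Sum>s\<in>{1..n}. z s * ((?c s + 1) * (2 * of_nat (M s) + of_nat M0 * ?c s)) * ?X s))" .
  also have "\<dots> = to_fract ?rhs"
    unfolding c0_def
    by (simp only: to_fract_add to_fract_mult to_fract_sum to_fract_P const_hom.hom_mult const_hom.hom_of_int
      const_hom.hom_add const_hom.hom_minus const_hom.hom_sum const_hom.hom_of_nat const_hom.hom_numeral const_1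
      to_fract_diff to_fract_1 to_fract.hom_of_nat to_fract.hom_numeral to_fract.hom_of_int of_int_mult of_int_add of_int_diff of_int_of_nat_eq of_int_1 of_int_numeral of_int_sum
      distrib_left sum_distrib_left mult.assoc mult.left_commute[of Phi])
  finally show ?thesis
    by (simp only: to_fract_eq_iff)
qed

end

section \<open>Reduction modulo a prime kills total derivatives\<close>

interpretation reduce: comm_ring_hom "Poly_Mapping.map of_int :: int mpoly \<Rightarrow> 'a::comm_ring_1 mpoly"
  by (rule of_int_hom.map_mpoly_hom)

definition reduced_taylor_coeff ::
  "(nat \<Rightarrow> int) \<Rightarrow> (nat \<Rightarrow>\<^sub>0 nat) \<Rightarrow> int mpoly mpoly \<Rightarrow> 'a::comm_ring_1 mpoly" where
  "reduced_taylor_coeff q e f = Poly_Mapping.map of_int (taylor_coeff q f e)"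

lemma reduced_taylor_coeff_add:
  "reduced_taylor_coeff q e (f + g) = reduced_taylor_coeff q e f + reduced_taylor_coeff q e g"
  by (simp only: reduced_taylor_coeff_def taylor_coeff_eq translate_add lookup_add reduce.hom_add)

lemma reduced_taylor_coeff_const_mult:
  "reduced_taylor_coeff q e (const a * f) = Poly_Mapping.map of_int a * reduced_taylor_coeff q e f"
  by (simp only: reduced_taylor_coeff_def taylor_coeff_eq translate_mult translate_const lookup_const_times
      reduce.hom_mult)

lemma reduced_taylor_coeff_0: "reduced_taylor_coeff q e 0 = 0"
  using reduced_taylor_coeff_const_mult[of q e 0 0] by simp

lemma reduced_taylor_coeff_sum:
  "reduced_taylor_coeff q e (\<Sum>i\<in>A. f i) = (\<Sum>i\<in>A. reduced_taylor_coeff q e (f i))"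
  by (induction A rule: infinite_finite_induct)
    (simp_all add: reduced_taylor_coeff_add reduced_taylor_coeff_0)

text \<open>
  The derivative of \<open>(t - q)\<^bsup>r + 1\<^esup>\<close> is \<open>(r + 1) (t - q)\<^bsup>r\<^esup>\<close>, so a derivative has no terms of degree \<open>r\<close> in
  \<open>t - q\<close> in characteristic dividing \<open>r + 1\<close>; exponents \<open>r = l p - 1\<close> are the case of interest.
\<close>

lemma reduced_taylor_coeff_pd:
  assumes "of_nat (Poly_Mapping.lookup e i + 1) = (0 :: 'a::comm_ring_1)"
  shows "reduced_taylor_coeff q e (pd i f) = (0 :: 'a mpoly)"
proof -
  have "Poly_Mapping.map of_int (of_nat (Poly_Mapping.lookup e i + 1) :: int mpoly) =
      const (of_nat (Poly_Mapping.lookup e i + 1) :: 'a)"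
    by (simp only: reduce.hom_of_nat const_hom.hom_of_nat)
  then show ?thesis
    by (simp only: reduced_taylor_coeff_def taylor_coeff_eq pd_translate[symmetric] lookup_pd reduce.hom_mult
        assms const_0 mult_zero_left)
qed

section \<open>Iterating the raising operator\<close>

lemma ze_apply:
  "ze n m w J = (\<Sum>s\<in>{1..n}. if J s < m s
     then var s * (of_nat ((J s + 1) * (m s - J s)) * w (J(s := J s + 1))) else 0)"
proof -
  have "e_act i f r' = (if r' < i then of_nat ((r' + 1) * (i - r')) * f (r' + 1) else 0)"
    for i r' and f :: "nat \<Rightarrow> 'a mpoly"
  proof -
    have "e_act i f r' = (\<Sum>r\<in>{1..i}. if r = r' + 1 then f r * of_nat (r * (i - r + 1)) else 0)"
      unfolding e_act_def by (intro sum.cong refl) auto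
    also have "\<dots> = (if r' + 1 \<in> {1..i} then f (r' + 1) * of_nat ((r' + 1) * (i - (r' + 1) + 1)) else 0)"
      by (simp only: sum.delta finite_atLeastAtMost)
    finally show ?thesis
      by (simp add: mult.commute Suc_diff_Suc del: of_nat_mult of_nat_Suc of_nat_add)
  qed
  then show ?thesis
    unfolding ze_def e_act_slot_def by (intro sum.cong refl) (simp del: of_nat_mult of_nat_add of_nat_Suc)
qed

lemma ze_const_mult: "ze n m (\<lambda>J. const a * w J) = (\<lambda>J. const a * ze n m w J)"
  unfolding ze_apply by (simp add: sum_distrib_left mult_ac if_distrib[of "\<lambda>x. _ * x"] cong: if_cong)

lemma ze_funpow_chain:
  assumes "\<And>r. ze n m (V r) = (\<lambda>J. const (\<gamma> r) * V (r + 1) J)"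
  shows "(ze n m ^^ r) (V 0) = (\<lambda>J. const (\<Prod>i<r. \<gamma> i) * V r J)"
proof (induction r)
  case (Suc r)
  then show ?case
    by (simp only: funpow.simps o_apply ze_const_mult assms prod.lessThan_Suc const_mult mult.assoc Suc_eq_plus1[symmetric])
qed simp

context master_data
begin

definition exponent :: "nat \<Rightarrow> (nat \<Rightarrow> nat) \<Rightarrow> nat \<Rightarrow>\<^sub>0 nat" where
  "exponent r J = Poly_Mapping.single 0 r + (\<Sum>s\<in>{1..n}. Poly_Mapping.single s (J s))"

lemma lookup_exponent:
  "Poly_Mapping.lookup (exponent r J) 0 = r"
  "s \<in> {1..n} \<Longrightarrow> Poly_Mapping.lookup (exponent r J) s = J s"
  by (auto simp: exponent_def lookup_add lookup_sum lookup_single when_def)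

lemma exponent_Suc:
  "exponent r J + Poly_Mapping.single 0 1 = exponent (r + 1) J"
  by (simp only: exponent_def single_add add_ac)

lemma exponent_upd:
  assumes "s \<in> {1..n}"
  shows "exponent r J + Poly_Mapping.single s 1 = exponent r (J(s := J s + 1))"
  using assms
  by (intro poly_mapping_eqI) (auto simp: exponent_def lookup_add lookup_sum lookup_single when_def)

definition admissible :: "(nat \<Rightarrow> nat) \<Rightarrow> nat \<Rightarrow> (nat \<Rightarrow> nat) \<Rightarrow> bool" where
  "admissible m r J \<longleftrightarrow>
     (\<forall>s. s \<notin> {1..n} \<longrightarrow> J s = 0) \<and> (\<forall>s\<in>{1..n}. J s \<le> m s) \<and> (\<Sum>s\<in>{1..n}. J s) + r = k"

lemma admissible_upd:
  assumes "s \<in> {1..n}" "J s < m s"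
  shows "admissible m r (J(s := J s + 1)) \<longleftrightarrow> admissible m (r + 1) J"
proof -
  have "(\<Sum>u\<in>{1..n}. (J(s := J s + 1)) u) = (\<Sum>u\<in>{1..n}. J u) + 1"
    using assms by (simp add: sum.remove[of _ s])
  then show ?thesis
    using assms unfolding admissible_def by auto
qed

text \<open>
  Level \<open>r\<close> collects the coefficients with \<open>x\<^sub>0\<close>-exponent \<open>r\<close>, where \<open>r\<close> of the variables \<open>t\<^sub>i\<close> are left out
  of the weight functions; it is a vector of weight \<open>\<bar>m\<bar> - 2 (k - r)\<close>. Level 0 is the vector of hypergeometric
  Taylor coefficients.
\<close>

definition level_vector :: "(nat \<Rightarrow> nat) \<Rightarrow> (nat \<Rightarrow> int) \<Rightarrow> (nat \<Rightarrow>\<^sub>0 nat) \<Rightarrow> nat \<Rightarrow> (nat \<Rightarrow> nat) \<Rightarrow> 'a::comm_ring_1 mpoly" where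
  "level_vector m q e r J =
     (if admissible m r J then reduced_taylor_coeff q e (P (exponent r J)) else 0)"

lemma hypergeom_mod_eq_level_vector: "hypergeom_mod k n m M M2 M0 q e = level_vector m q e 0"
proof
  fix J
  show "hypergeom_mod k n m M M2 M0 q e J = level_vector m q e 0 J"
  proof (cases "J \<in> index_set k n m")
    case True
    then have "master_weight k n M M2 M0 J = P (exponent 0 J)"
      using master_weight_eq[of J] by (simp add: index_set_def exponent_def)
    with True show ?thesis
      by (simp add: hypergeom_mod_def hypergeom_int_def level_vector_def admissible_def index_set_def reduced_taylor_coeff_def)
  next
    case False
    then show ?thesis
      unfolding hypergeom_mod_def hypergeom_int_def level_vector_def admissible_def index_set_def by auto
  qed
qed

text \<open>
  Modulo \<open>p\<close> this is \<open>2 (r + 1) (1 + \<Sum>\<^sub>s M\<^sub>s + (k - 1) M\<^sup>0 - r K)\<close>, because \<open>M\<^sup>0 \<equiv> 2 K\<close>.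
\<close>

definition level_weight :: "nat \<Rightarrow> int" where
  "level_weight r = (int r + 1) * (2 * (1 + (\<Sum>s\<in>{1..n}. int (M s)) + (int k - 1) * int M0) - int M0 * int r)"

text \<open>In the total derivative identity, all derivatives disappear after reduction.\<close>

lemma reduced_total_derivative:
  assumes "\<And>i. i \<in> {1..k} \<Longrightarrow> of_nat (Poly_Mapping.lookup e i + 1) = (0 :: 'a::comm_ring_1)"
  shows "const (of_int (level_weight r)) * reduced_taylor_coeff q e (P (exponent (r + 1) J)) +
     (\<Sum>s\<in>{1..n}. var s * const (of_int ((int (J s) + 1) * (2 * int (M s) + int M0 * int (J s)))) *
        reduced_taylor_coeff q e (P (exponent r (J(s := J s + 1))))) = (0 :: 'a mpoly)"
proof -
  let ?\<theta> = "reduced_taylor_coeff q e :: int mpoly mpoly \<Rightarrow> 'a mpoly"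
  let ?D = "\<Sum>i\<in>{1..k}. pd i (Q i (exponent r J))"
  have "?\<theta> ?D = (\<Sum>i\<in>{1..k}. 0)"
    unfolding reduced_taylor_coeff_sum
    by (intro sum.cong refl reduced_taylor_coeff_pd assms)
  then have "?\<theta> (2 * ?D) = 0"
    by (simp only: mult_2 reduced_taylor_coeff_add sum.neutral_const add_0_left)
  also have "2 * ?D = const (of_int (level_weight r)) * P (exponent (r + 1) J) +
     (\<Sum>s\<in>{1..n}. const (var s * of_int ((int (J s) + 1) * (2 * int (M s) + int M0 * int (J s)))) *
        P (exponent r (J(s := J s + 1))))"
    unfolding total_derivative lookup_exponent(1) exponent_Suc level_weight_def
    by (intro arg_cong2[where f = "(+)"] sum.cong refl) (simp only: lookup_exponent(2) exponent_upd)
  finally show ?thesis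
    unfolding reduced_taylor_coeff_add reduced_taylor_coeff_sum reduced_taylor_coeff_const_mult
    by (simp only: reduce.hom_mult reduce.hom_of_int of_int_hom.map_mpoly_var const_hom.hom_of_int)
qed

text \<open>
  Multiplied by \<open>-c\<close>, the \<open>z\<^sub>s\<close>-part of the reduced total derivative identity is \<open>ze\<close> applied to level \<open>r\<close>.
  The truncation \<open>J\<^sub>s \<le> m\<^sub>s\<close> is harmless because the structure constant \<open>m\<^sub>s - J\<^sub>s\<close> vanishes precisely at the
  boundary.
\<close>

lemma ze_level_vector:
  fixes e :: "nat \<Rightarrow>\<^sub>0 nat" and c :: "'a::field"
  assumes e: "\<And>i. i \<in> {1..k} \<Longrightarrow> of_nat (Poly_Mapping.lookup e i + 1) = (0 :: 'a)"
    and c: "\<And>s j. s \<in> {1..n} \<Longrightarrow> j \<le> m s \<Longrightarrow>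
       c * of_int (2 * int (M s) + int M0 * int j) = - of_nat (m s - j)"
  shows "ze n m (level_vector m q e r) = (\<lambda>J. const (c * of_int (level_weight r)) * (level_vector m q e (r + 1) J :: 'a mpoly))"
proof
  fix J :: "nat \<Rightarrow> nat"
  let ?\<theta> = "\<lambda>r J. reduced_taylor_coeff q e (P (exponent r J)) :: 'a mpoly"
  let ?J = "\<lambda>s. J(s := J s + 1)"
  note ok = admissible_upd[of _ J m r]
  show "ze n m (level_vector m q e r) J = const (c * of_int (level_weight r)) * (level_vector m q e (r + 1) J :: 'a mpoly)"
  proof (cases "admissible m (r + 1) J")
    case False
    then have "level_vector m q e r (?J s) = (0 :: 'a mpoly)" if "s \<in> {1..n}" "J s < m s" for s
      using ok[OF that] unfolding level_vector_def by (simp only: if_False)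
    with False show ?thesis
      unfolding ze_apply level_vector_def[of m q e "r + 1"] by (simp only: if_False mult_zero_right if_cancel sum.neutral_const cong: if_cong sum.cong)
  next
    case True
    have "ze n m (level_vector m q e r) J = (\<Sum>s\<in>{1..n}. var s * (of_nat ((J s + 1) * (m s - J s)) * ?\<theta> r (?J s)))"
      unfolding ze_apply
    proof (intro sum.cong refl)
      fix s assume s: "s \<in> {1..n}"
      show "(if J s < m s then var s * (of_nat ((J s + 1) * (m s - J s)) * level_vector m q e r (?J s)) else 0) =
          var s * (of_nat ((J s + 1) * (m s - J s)) * ?\<theta> r (?J s))"
      proof (cases "J s < m s")
        case True
        then have "level_vector m q e r (?J s) = ?\<theta> r (?J s)"
          using ok[OF s True] \<open>admissible m (r + 1) J\<close> by (simp only: level_vector_def if_True)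
        with True show ?thesis by (simp only: if_True)
      qed simp
    qed
    also have "\<dots> = (\<Sum>s\<in>{1..n}. - const c * (var s * const (of_int ((int (J s) + 1) * (2 * int (M s) + int M0 * int (J s)))) *
        ?\<theta> r (?J s)))"
    proof (intro sum.cong refl)
      fix s assume s: "s \<in> {1..n}"
      then have "J s \<le> m s" using True by (auto simp: admissible_def)
      have "- c * of_int ((int (J s) + 1) * (2 * int (M s) + int M0 * int (J s))) =
          - ((of_nat (J s) + 1) * (c * of_int (2 * int (M s) + int M0 * int (J s))))"
        by (simp only: of_int_mult of_int_add of_int_of_nat_eq of_int_1 mult_ac mult_minus_left)
      also have "\<dots> = of_nat ((J s + 1) * (m s - J s))"
        unfolding c[OF s \<open>J s \<le> m s\<close>] by (simp add: distrib_right del: of_nat_diff)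
      finally have "const (of_nat ((J s + 1) * (m s - J s))) =
         - const c * const (of_int ((int (J s) + 1) * (2 * int (M s) + int M0 * int (J s))))"
        by (simp only: const_hom.hom_mult[symmetric] const_hom.hom_uminus[symmetric])
      then show "var s * (of_nat ((J s + 1) * (m s - J s)) * ?\<theta> r (?J s)) =
        - const c * (var s * const (of_int ((int (J s) + 1) * (2 * int (M s) + int M0 * int (J s)))) * ?\<theta> r (?J s))"
        by (simp only: const_hom.hom_of_nat mult_ac)
    qed
    also have "\<dots> = - const c * (\<Sum>s\<in>{1..n}. var s * const (of_int ((int (J s) + 1) * (2 * int (M s) + int M0 * int (J s)))) *
        ?\<theta> r (?J s))"
      by (rule sum_distrib_left[symmetric])
    also have "(\<Sum>s\<in>{1..n}. var s * const (of_int ((int (J s) + 1) * (2 * int (M s) + int M0 * int (J s)))) *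
        ?\<theta> r (?J s)) = - (const (of_int (level_weight r)) * ?\<theta> (r + 1) J)"
      using reduced_total_derivative[OF e, of r q J] by (simp only: eq_neg_iff_add_eq_0 add.commute)
    also have "- const c * - (const (of_int (level_weight r)) * ?\<theta> (r + 1) J) = const (c * of_int (level_weight r)) * ?\<theta> (r + 1) J"
      by (simp only: const_mult minus_mult_minus mult.assoc)
    also have "?\<theta> (r + 1) J = level_vector m q e (r + 1) J"
      using True unfolding level_vector_def by (simp only: if_True)
    finally show ?thesis .
  qed
qed

end

lemma of_int_mod_ring_eq_0_iff:
  "(of_int x :: 'a::prime_card mod_ring) = 0 \<longleftrightarrow> int CARD('a) dvd x"
  by (transfer, simp add: dvd_eq_mod_eq_0)

theorem theorem3p3:
  fixes k n p \<kappa> ell K M0 :: nat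
    and m M l :: "nat \<Rightarrow> nat"
    and M2 :: "nat \<Rightarrow> nat \<Rightarrow> nat"
    and q :: "nat \<Rightarrow> int"
  assumes "p = CARD('p::prime_card)" and "p > 2"
    and "k > 0" and "n > 0" and "\<kappa> > 0" and "\<not> p dvd \<kappa>"
    and "\<And>s. s \<in> {1..n} \<Longrightarrow> m s > 0"
    and "\<And>s. s \<in> {1..n} \<Longrightarrow> M s > 0"
    and "\<And>i j. 1 \<le> i \<Longrightarrow> i < j \<Longrightarrow> j \<le> n \<Longrightarrow> M2 i j > 0"
    and "M0 > 0" and "K > 0" and "ell > 0"
    and "\<And>s. s \<in> {1..n} \<Longrightarrow>
          (of_nat (M s) :: 'p mod_ring) = - (of_nat (m s) / of_nat \<kappa>)"
    and "\<And>i j. 1 \<le> i \<Longrightarrow> i < j \<Longrightarrow> j \<le> n \<Longrightarrow>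
          (of_nat (M2 i j) :: 'p mod_ring) = of_nat (m i * m j) / of_nat (2 * \<kappa>)"
    and "(of_nat M0 :: 'p mod_ring) = 2 / of_nat \<kappa>"
    and "(of_nat K :: 'p mod_ring) = 1 / of_nat \<kappa>"
    and "[(int ell - 1) * int K - (\<Sum>s\<in>{1..n}. int (M s)) - (int k - 1) * int M0 = 1] (mod int p)"
    and "\<And>i. i \<in> {1..k} \<Longrightarrow> l i > 0"
  shows "(ze n m ^^ ell)
           (hypergeom_mod k n m M M2 M0 q (\<Sum>i\<in>{1..k}. Poly_Mapping.single i (l i * p - 1))
             :: (nat \<Rightarrow> nat) \<Rightarrow> 'p mod_ring mpoly)
         = (\<lambda>_. 0)"
proof -
  note p = assms(1) and p2 = assms(2) and \<kappa> = assms(6) and M_pos = assms(8) and M = assms(13)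
    and M0 = assms(15) and K = assms(16) and ell_eq = assms(17) and l = assms(18)
  interpret master_data k n M M2 M0
    by unfold_locales (rule M_pos)
  define e where "e = (\<Sum>i\<in>{1..k}. Poly_Mapping.single i (l i * p - 1))"
  have of_nat_0: "of_nat r = (0 :: 'p mod_ring) \<longleftrightarrow> p dvd r" for r
    using of_int_mod_ring_eq_0_iff[of "int r", where 'a = 'p] by (simp add: p)
  have two: "(2 :: 'p mod_ring) \<noteq> 0"
    using of_nat_0[of 2] p2 by (auto dest: dvd_imp_le)
  have kap: "(of_nat \<kappa> :: 'p mod_ring) \<noteq> 0"
    using \<kappa> by (simp add: of_nat_0)
  have e: "of_nat (Poly_Mapping.lookup e i + 1) = (0 :: 'p mod_ring)" if i: "i \<in> {1..k}" for i
  proof -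
    have "Poly_Mapping.lookup e i = l i * p - 1"
      using i by (simp add: e_def lookup_sum lookup_single when_def)
    moreover have "l i * p > 0" using l[OF i] p2 by simp
    ultimately have "Poly_Mapping.lookup e i + 1 = l i * p" by simp
    then show ?thesis by (simp only: of_nat_0 dvd_triv_right)
  qed
  \<comment> \<open>\<open>c\<close> is the inverse of \<open>M\<^sup>0\<close> modulo \<open>p\<close>; it normalises \<open>2 M\<^sub>s + M\<^sup>0 j\<close> to \<open>-(m\<^sub>s - j)\<close>.\<close>
  define c :: "'p mod_ring" where "c = of_nat \<kappa> / 2"
  have c: "c * of_int (2 * int (M s) + int M0 * int j) = - of_nat (m s - j)"
    if "s \<in> {1..n}" "j \<le> m s" for s j
    using that kap two by (simp add: c_def M M0 field_simps)
  \<comment> \<open>This is where the congruence for \<open>\<ell>\<close> enters: the last of the \<open>\<ell>\<close> scalars vanishes.\<close>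
  have zero: "c * of_int (level_weight (ell - 1)) = 0"
  proof -
    have "int p dvd (int ell - 1) * int K - (\<Sum>s\<in>{1..n}. int (M s)) - (int k - 1) * int M0 - 1"
      using ell_eq by (simp only: cong_iff_dvd_diff)
    then have "(of_int ((int ell - 1) * int K - (\<Sum>s\<in>{1..n}. int (M s)) - (int k - 1) * int M0 - 1) :: 'p mod_ring) = 0"
      by (simp only: p of_int_mod_ring_eq_0_iff)
    moreover have "(of_int (2 * int K - int M0) :: 'p mod_ring) = 0" by (simp add: M0 K)
    moreover have "level_weight (ell - 1) = int ell * (int ell - 1) * (2 * int K - int M0)
        - 2 * int ell * ((int ell - 1) * int K - (\<Sum>s\<in>{1..n}. int (M s)) - (int k - 1) * int M0 - 1)"
      using assms(12) by (simp add: level_weight_def of_nat_diff algebra_simps)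
    ultimately show ?thesis
      by (simp only: of_int_mult of_int_diff[of "int ell * (int ell - 1) * (2 * int K - int M0)"] mult_zero_right diff_0_right)
  qed
  have chain: "(ze n m ^^ ell) (level_vector m q e 0) = (\<lambda>J. const (\<Prod>i<ell. c * of_int (level_weight i)) * (level_vector m q e ell J :: 'p mod_ring mpoly))"
    by (rule ze_funpow_chain) (rule ze_level_vector[OF e c])
  have "(\<Prod>i<ell. c * of_int (level_weight i)) = 0"
    using zero assms(12) by (intro prod_zero) (auto intro: bexI[of _ "ell - 1"])
  then show ?thesis
    unfolding hypergeom_mod_eq_level_vector e_def[symmetric] chain by (simp only: const_0 mult_zero_left)
qed

end
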